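(* Let $M\in(\mathbb{Z}_{\ge0}\cup\{-\infty\})^{d\times m}$ and let $P=\mathrm{tconv}(M)$ be the corresponding tropical lattice polytope (the tropical convex hull of the columns of $M$). Then $$\mathrm{tbvol}(P)\le\mathrm{qtvol}^+(M).$$
   Context: $\mathbb{T}=\mathbb{R}\cup\{-\infty\}$ with $x\oplus y=\max(x,y)$, $x\odot y=x+y$. For $V\subseteq\mathbb{T}^d$, $\mathrm{tconv}(V)=\{\bigoplus_{j=1}^n\lambda_j\odot v_j:\lambda_j\in\mathbb{T},\ \bigoplus_j\lambda_j=0,\ v_j\in V\}$. A tropical polytope is $\mathrm{tconv}(V)$ for a finite set $V$; its vertices are the elements of its unique minimal generating set. Covector decomposition: let $v_1,\dots,v_n$ be the vertices of $P$, $v_j=(v_{1j},\dots,v_{dj})$, and put $v_{0j}=0$, $x_0=0$. For $G\subseteq\{0,\dots,d\}\times[n]$ let $C_G=\{x\in\mathbb{T}^d: v_{kj}+x_i\le v_{ij}+x_k\text{ for all }(i,j)\in G,\ k\in\{0,\dots,d\}\}$. The closed cells of the covector decomposition of $P$ are the nonempty $C_G$ for which every $i\in\{0,\dots,d\}$ occurs in some $(i,j)\in G$ and every $j\in[n]$ occurs in some $(i,j)\in G$ with $v_{ij}\ne-\infty$. Their union is $P$, and their images under $x\mapsto(b^{x_1},\dots,b^{x_d})$ ($b>1$, $b^{-\infty}=0$) are convex polytopes forming a polyhedral complex; the dimension of a cell is the dimension of its image. The $d$-trunk $\mathrm{Tr}_d(P)$ is the union of all closed cells of dimension $d$. Tropical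 barycentric volume: $\mathrm{tbvol}(P)=\max_{x\in\mathrm{Tr}_d(P)}(x_1+\dots+x_d)$, with $\max\emptyset=-\infty$. Tropical (upper) dequantized volume: let $\mathbb{K}=\mathbb{R}\{\!\{t\}\!\}$ be the (real closed) field of generalized convergent Puiseux series, i.e. series $f=\sum_k a_k t^{r_k}$ with real coefficients and real exponents $r_0>r_1>\cdots$, a finite sequence or one tending to $-\infty$, absolutely convergent for all sufficiently large real $t$. For $f\neq0$ (with $a_0\ne0$) let $\mathrm{val}(f)=r_0$, and $\mathrm{val}(0)=-\infty$; $\mathrm{val}$ is applied to matrices entrywise. For $\mathbf{M}\in\mathbb{K}^{d\times m}$, $\mathrm{vol}\,\mathbf{M}\in\mathbb{K}$ is the Euclidean $d$-volume of the convex hull of the columns of $\mathbf{M}$ over the real closed field $\mathbb{K}$ (equivalently, the element of $\mathbb{K}$ whose value at all large $t$ is the $d$-volume of the convex hull of the columns of $\mathbf{M}(t)$). Then $\mathrm{qtvol}^+(M)=\sup\{\mathrm{val}\,\mathrm{vol}\,\mathbf{M}:\mathbf{M}\in\mathbb{K}^{d\times m},\ \mathrm{val}\,\mathbf{M}=M\}$. *)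

theory Defs
  imports "HOL-Analysis.Analysis"
begin

section \<open>Tropical polytopes\<close>

text \<open>
  The tropical semiring is the set of extended reals different from \<open>\<infinity>\<close>, with the maximum as
  addition and \<open>+\<close> as multiplication. Points are vectors over \<^typ>\<open>ereal\<close>, so membership in
  \<open>trop_space\<close> is always stated explicitly.
\<close>

definition trop_space :: "(ereal^'d) set" where
  "trop_space = {x. \<forall>i. x $ i \<noteq> \<infinity>}"

text \<open>
  The supremum over the empty set is \<open>-\<infinity>\<close>, the tropical zero, so the condition on \<open>l\<close> forces \<open>n > 0\<close>.
\<close>

definition tconv :: "(ereal^'d) set \<Rightarrow> (ereal^'d) set" where
  "tconv V = {x. \<exists>(n::nat) (l :: nat \<Rightarrow> ereal) (v :: nat \<Rightarrow> ereal^'d).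
     (\<forall>j<n. l j \<noteq> \<infinity> \<and> v j \<in> V) \<and> (SUP j\<in>{..<n}. l j) = 0 \<and>
     x = (\<chi> i. SUP j\<in>{..<n}. l j + v j $ i)}"

definition min_generating :: "(ereal^'d) set \<Rightarrow> (ereal^'d) set \<Rightarrow> bool" where
  "min_generating P V \<longleftrightarrow> V \<subseteq> trop_space \<and> tconv V = P \<and> (\<forall>W. W \<subset> V \<longrightarrow> tconv W \<noteq> P)"

definition tvertices :: "(ereal^'d) set \<Rightarrow> (ereal^'d) set" where
  "tvertices P = (THE V. min_generating P V)"


section \<open>Covector decomposition, trunk and barycentric volume\<close>

text \<open>
  The index set \<open>{0,\<dots>,d}\<close> is \<^typ>\<open>'d option\<close>, with \<^term>\<open>None\<close> in the role of the index \<open>0\<close>.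
  The index set \<open>[n]\<close> of the vertices is the set of vertices itself.
\<close>

fun hcoord :: "ereal^'d \<Rightarrow> 'd option \<Rightarrow> ereal" where
  "hcoord x None = 0"
| "hcoord x (Some i) = x $ i"

definition cov_cell :: "('d option \<times> (ereal^'d)) set \<Rightarrow> (ereal^'d) set" where
  "cov_cell G = {x \<in> trop_space. \<forall>(i, v) \<in> G. \<forall>k. hcoord v k + hcoord x i \<le> hcoord v i + hcoord x k}"

definition closed_cells :: "(ereal^'d) set \<Rightarrow> (ereal^'d) set set" where
  "closed_cells P = {cov_cell G | G.
     G \<subseteq> UNIV \<times> tvertices P \<and> cov_cell G \<noteq> {} \<and>
     (\<forall>i. \<exists>v. (i, v) \<in> G) \<and>
     (\<forall>v \<in> tvertices P. \<exists>i. (i, v) \<in> G \<and> hcoord v i \<noteq> -\<infinity>)}"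

definition texp :: "real \<Rightarrow> ereal^'d \<Rightarrow> real^'d" where
  "texp b x = (\<chi> i. if x $ i = -\<infinity> then 0 else b powr real_of_ereal (x $ i))"

definition trunk :: "real \<Rightarrow> (ereal^'d) set \<Rightarrow> (ereal^'d) set" where
  "trunk b P = \<Union>{C \<in> closed_cells P. aff_dim (texp b ` C) = int CARD('d)}"

text \<open>
  The trunk of a tropical polytope is compact (a finite union of closed cells), so the supremum is
  a maximum unless the trunk is empty, in which case it is \<open>-\<infinity>\<close>.
\<close>

definition tbvol :: "real \<Rightarrow> (ereal^'d) set \<Rightarrow> ereal" where
  "tbvol b P = (SUP x \<in> trunk b P. \<Sum>i\<in>UNIV. x $ i)"


section \<open>Generalized convergent Puiseux series\<close>

text \<open>
  A series is represented by its coefficient function, sending an exponent \<open>r\<close> to the coefficient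
  of \<open>t\<^sup>r\<close>. The finiteness condition says that the exponents with nonzero coefficient form a
  strictly decreasing sequence that is finite or tends to \<open>-\<infinity>\<close>.
\<close>

typedef puiseux = "{a :: real \<Rightarrow> real. (\<forall>s. finite {r. s \<le> r \<and> a r \<noteq> 0}) \<and>
    (\<forall>\<^sub>F t in at_top. (\<lambda>r. \<bar>a r * t powr r\<bar>) summable_on UNIV)}"
  morphisms pcoeff Abs_puiseux
  by (rule exI[of _ "\<lambda>_. 0"]) auto

instantiation puiseux :: zero
begin

definition zero_puiseux :: puiseux where
  "0 = Abs_puiseux (\<lambda>_. 0)"

instance ..

end

definition pval :: "puiseux \<Rightarrow> ereal" where
  "pval f = (if f = 0 then -\<infinity> else ereal (GREATEST r. pcoeff f r \<noteq> 0))"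

definition peval :: "real \<Rightarrow> puiseux \<Rightarrow> real" where
  "peval t f = (\<Sum>\<^sub>\<infinity>r\<in>UNIV. pcoeff f r * t powr r)"


section \<open>Dequantized volume\<close>

text \<open>
  The volume over the field of Puiseux series is the series whose value at all large \<open>t\<close> is the
  Euclidean volume of the convex hull of the columns evaluated at \<open>t\<close>. It exists because, for all
  large \<open>t\<close>, the combinatorial type of the hull is constant; it is unique because a
  nonzero series does not vanish for large \<open>t\<close>.
\<close>

definition pvol :: "puiseux^'m^'d \<Rightarrow> puiseux" where
  "pvol A = (THE f. \<forall>\<^sub>F t in at_top.
     peval t f = measure lebesgue (convex hull (columns (map_matrix (peval t) A))))"

definition qtvol_upper :: "ereal^'m^'d \<Rightarrow> ereal" where
  "qtvol_upper M = Sup {pval (pvol A) | A. map_matrix pval A = M}"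

end

theory Submission
  imports Defs
begin

text \<open>
  A full-dimensional cell of the covector decomposition cannot have one vertex in two sectors, for it
  would then lie in a hyperplane after exponentiation. So every point \<open>x\<close> of the trunk with finite
  coordinates selects \<open>d + 1\<close> distinct columns of \<open>M\<close>, one for each sector, and the sector
  inequalities say that the identity permutation is maximal in the tropical determinant of these
  columns, with value at least \<open>\<Sum>x\<^sub>i\<close>. A lift of \<open>M\<close> by monomials whose coefficients are \<open>1\<close> on
  the corresponding diagonal and small elsewhere avoids cancellation, so that the volume of its convex
  hull is at least a constant times \<open>t\<close> to the power \<open>\<Sum>x\<^sub>i\<close>.

  It remains to see that the volume of this lift is a Puiseux series. As the entries are polynomials in
  \<open>t\<close>, each hull is triangulated without new vertices; hence its volume is, for every \<open>t\<close>, the value of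
  one of finitely many polynomials. The volume depends continuously on \<open>t\<close>, so eventually it is always
  the same one.
\<close>

section \<open>Triangulations without new vertices\<close>

text \<open>Simplices are recorded by their vertex sets. Two of them need not meet face to face: an
  overlap of dimension below \<open>k\<close> is enough for volumes to add up when \<open>k\<close>
  is the dimension of the space.\<close>

definition triangulates :: "'a::euclidean_space set set \<Rightarrow> nat \<Rightarrow> 'a set \<Rightarrow> 'a set \<Rightarrow> bool" where
  "triangulates \<T> k S P \<longleftrightarrow> (\<forall>T\<in>\<T>. T \<subseteq> S \<and> card T = Suc k) \<and> (\<Union>T\<in>\<T>. convex hull T) = P \<and>
    (\<forall>T\<in>\<T>. \<forall>U\<in>\<T>. T \<noteq> U \<longrightarrow> aff_dim (convex hull T \<inter> convex hull U) < int k)"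

text \<open>
  Cone off from a point \<open>a\<close> of \<open>S\<close> the triangulations of the facets that do not contain \<open>a\<close>. The
  cones cover the relative interior by shooting rays from \<open>a\<close>, hence the whole polytope by
  closedness; a ray from \<open>a\<close> meets the union of these facets at most once, so cones intersect in
  cones over the intersections of their bases.
\<close>

lemma triangulates_exists:
  fixes S :: "'a::euclidean_space set"
  assumes "finite S" "aff_dim S = int k"
  shows "\<exists>\<T>. triangulates \<T> k S (convex hull S)"
  using assms
proof (induction k arbitrary: S)
  case 0
  then obtain a where "S = {a}"
    by (metis aff_dim_eq_0 of_nat_0)
  then show ?case
    by (intro exI[of _ "{{a}}"]) (auto simp: triangulates_def)
next
  case (Suc k)
  define P where "P = convex hull S"
  have dimP: "aff_dim P = int (Suc k)"
    using Suc.prems by (simp add: P_def aff_dim_convex_hull)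
  have polyP: "polytope P"
    using Suc.prems(1) P_def polytope_def by blast
  then have cP: "convex P" "compact P" "bounded P" "polyhedron P"
    by (auto simp: polytope_imp_convex polytope_imp_compact polytope_imp_bounded polytope_imp_polyhedron)
  have "S \<noteq> {}"
    using Suc.prems by auto
  then obtain a where a: "a \<in> S"
    by auto
  have aP: "a \<in> P"
    using a by (simp add: P_def hull_inc)
  define \<F> where "\<F> = {F. F facet_of P \<and> a \<notin> F}"
  have F_face: "F face_of P" "aff_dim F = int k" "a \<notin> F" "convex F" "F \<noteq> P" if "F \<in> \<F>" for F
    using that dimP aP by (auto simp: \<F>_def facet_of_def intro: face_of_imp_convex)

  \<comment> \<open>Triangulated facets avoiding \<open>a\<close> and the cones over them\<close>
  have "\<exists>\<T>. triangulates \<T> k S F" if FF: "F \<in> \<F>" for F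
  proof -
    \<comment> \<open>A face of the hull of the finite set \<open>S\<close> is spanned by points of
      \<open>S\<close>; this is why no new vertices arise.\<close>
    obtain S' where S': "S' \<subseteq> S" "F = convex hull S'"
      using face_of_convex_hull_subset[of S F] F_face(1)[OF FF] Suc.prems(1) finite_imp_compact P_def by metis
    have "finite S'"
      using S'(1) Suc.prems(1) by (rule finite_subset)
    moreover have "aff_dim S' = int k"
      using F_face(2)[OF FF] S'(2) by (simp add: aff_dim_convex_hull)
    ultimately obtain \<T> where "triangulates \<T> k S' (convex hull S')"
      using Suc.IH by blast
    with S' show ?thesis
      unfolding triangulates_def by (meson subset_trans)
  qed
  then obtain \<tau> where \<tau>0: "\<And>F. F \<in> \<F> \<Longrightarrow> triangulates (\<tau> F) k S F"
    by metis
  have \<tau>: "T \<subseteq> S" "card T = Suc k" if "F \<in> \<F>" "T \<in> \<tau> F" for F T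
    using \<tau>0[OF that(1)] that(2) by (simp_all add: triangulates_def)
  have \<tau>_Un: "(\<Union>T\<in>\<tau> F. convex hull T) = F" if "F \<in> \<F>" for F
    using \<tau>0[OF that] by (simp add: triangulates_def)
  have \<tau>_Int: "aff_dim (convex hull T \<inter> convex hull U) < int k"
    if "F \<in> \<F>" "T \<in> \<tau> F" "U \<in> \<tau> F" "T \<noteq> U" for F T U
    using \<tau>0[OF that(1)] that(2-) by (simp add: triangulates_def)
  have TF: "convex hull T \<subseteq> F" "T \<subseteq> F" "T \<noteq> {}" "finite T" if "F \<in> \<F>" "T \<in> \<tau> F" for F T
  proof -
    show "convex hull T \<subseteq> F"
      using \<tau>_Un[OF that(1)] that(2) by blast
    then show "T \<subseteq> F"
      using hull_subset[of T convex] by blast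
    show "T \<noteq> {}" "finite T"
      using \<tau>(2)[OF that] by (auto intro: card_ge_0_finite)
  qed
  define \<T> where "\<T> = {insert a T | T F. F \<in> \<F> \<and> T \<in> \<tau> F}"
  have "T \<subseteq> S \<and> card T = Suc (Suc k)" if "T \<in> \<T>" for T
  proof -
    from that obtain T' F where T': "F \<in> \<F>" "T' \<in> \<tau> F" "T = insert a T'"
      by (auto simp: \<T>_def)
    then have "a \<notin> T'"
      using TF F_face by blast
    then show ?thesis
      using \<tau>[OF T'(1,2)] TF(4)[OF T'(1,2)] T'(3) a by simp
  qed

  \<comment> \<open>The cones cover the polytope\<close>
  moreover have "(\<Union>T\<in>\<T>. convex hull T) = P"
  proof
    have sub: "T \<subseteq> S" if "T \<in> \<T>" for T
      using that \<tau>(1) a by (auto simp: \<T>_def)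
    then show "(\<Union>T\<in>\<T>. convex hull T) \<subseteq> P"
      unfolding P_def by (meson UN_least hull_mono)
    have "finite \<T>"
      using sub Suc.prems(1) by (meson Pow_iff finite_Pow_iff finite_subset subsetI)
    then have cl: "closed (\<Union>T\<in>\<T>. convex hull T)"
      using sub Suc.prems(1)
      by (intro closed_UN) (meson compact_imp_closed compact_convex_hull finite_imp_compact finite_subset)+
    have "rel_interior P \<subseteq> (\<Union>T\<in>\<T>. convex hull T)"
    proof
      fix x assume x: "x \<in> rel_interior P"
      have xP: "x \<in> P"
        using x rel_interior_subset by blast
      \<comment> \<open>The direction \<open>l\<close> continues the segment from \<open>a\<close>
        through \<open>x\<close>. Since \<open>a\<close> may itself be a relative interior point,
        \<open>x = a\<close> can occur; then any nonzero direction inside the affine hull will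
        do.\<close>
      have "\<exists>l. x + l \<in> affine hull P \<and> l \<noteq> 0 \<and> (x = a \<or> l = x - a)"
      proof (cases "x = a")
        case True
        have "P \<noteq> {a}"
          using dimP by auto
        then obtain z where "z \<in> P" "z \<noteq> a"
          using aP by blast
        then show ?thesis
          using True by (intro exI[of _ "z - a"]) (auto simp: hull_inc)
      next
        case False
        have "2 *\<^sub>R x + (-1) *\<^sub>R a \<in> affine hull P"
          using xP aP by (intro mem_affine affine_affine_hull) (auto simp: hull_inc)
        then show ?thesis
          using False by (intro exI[of _ "x - a"]) (auto simp: scaleR_2 algebra_simps)
      qed
      then obtain l where l: "x + l \<in> affine hull P" "l \<noteq> 0" "x = a \<or> l = x - a"
        by blast
      obtain d where d: "0 < d" "x + d *\<^sub>R l \<in> rel_frontier P"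
        using ray_to_rel_frontier[OF \<open>bounded P\<close> x l(1,2)] by blast
      define y where "y = x + d *\<^sub>R l"
      obtain F where F: "F facet_of P" "y \<in> F"
        using d(2) rel_frontier_of_polyhedron[OF \<open>polyhedron P\<close>] unfolding y_def by blast
      have seg: "x \<in> closed_segment a y"
      proof (cases "x = a")
        case False
        with l have l': "l = x - a" by simp
        have "x = (1 - 1 / (1 + d)) *\<^sub>R a + (1 / (1 + d)) *\<^sub>R y"
        proof -
          have "y = (1 + d) *\<^sub>R x - d *\<^sub>R a"
            by (simp add: y_def l' algebra_simps)
          then have "(1 / (1 + d)) *\<^sub>R y = x - (d / (1 + d)) *\<^sub>R a"
            using d(1) by (simp only: scaleR_right_diff_distrib scaleR_scaleR) simp
          moreover have "1 - 1 / (1 + d) = d / (1 + d)"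
            using d(1) by (simp add: field_simps)
          ultimately show ?thesis by simp
        qed
        then show ?thesis
          using d(1) unfolding in_segment by (intro exI[of _ "1 / (1 + d)"]) (auto simp: field_simps)
      qed auto
      \<comment> \<open>Otherwise the whole segment from \<open>a\<close> to \<open>y\<close>, and
        with it the relative interior point \<open>x\<close>, would lie in the facet
        \<open>F\<close>.\<close>
      have "a \<notin> F"
      proof
        assume "a \<in> F"
        moreover have "convex F"
          using F(1) facet_of_imp_face_of face_of_imp_convex by blast
        ultimately have "x \<in> F"
          using seg F(2) closed_segment_subset by blast
        moreover have "F \<inter> rel_interior P = {}"
          using F(1) face_of_disjoint_rel_interior facet_of_imp_face_of facet_of_irrefl by blast
        ultimately show False
          using x by blast
      qed
      with F(1) have "F \<in> \<F>"
        by (simp add: \<F>_def)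
      with F(2) \<tau>_Un obtain T where T: "T \<in> \<tau> F" "y \<in> convex hull T"
        by blast
      have "closed_segment a y \<subseteq> convex hull (insert a T)"
        using T(2) hull_mono[of T "insert a T" convex]
        by (intro closed_segment_subset) (auto simp: hull_inc)
      then show "x \<in> (\<Union>T\<in>\<T>. convex hull T)"
        using seg T(1) \<open>F \<in> \<F>\<close> by (auto simp: \<T>_def)
    qed
    then have "closure (rel_interior P) \<subseteq> (\<Union>T\<in>\<T>. convex hull T)"
      using cl by (rule closure_minimal)
    moreover have "closure (rel_interior P) = P"
      using convex_closure_rel_interior[OF \<open>convex P\<close>] \<open>compact P\<close> by (simp add: compact_imp_closed)
    ultimately show "P \<subseteq> (\<Union>T\<in>\<T>. convex hull T)"
      by simp
  qed

  \<comment> \<open>Overlaps of two cones\<close>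
  moreover have "aff_dim (convex hull T \<inter> convex hull U) < int (Suc k)"
    if TU: "T \<in> \<T>" "U \<in> \<T>" "T \<noteq> U" for T U
  proof -
    obtain T1 F where T1: "F \<in> \<F>" "T1 \<in> \<tau> F" "T = insert a T1"
      using TU(1) by (auto simp: \<T>_def)
    obtain U1 G where U1: "G \<in> \<F>" "U1 \<in> \<tau> G" "U = insert a U1"
      using TU(2) by (auto simp: \<T>_def)
    define W where "W = convex hull T1 \<inter> convex hull U1"
    have "aff_dim W < int k"
    proof (cases "F = G")
      case True
      then show ?thesis
        using \<tau>_Int[of F T1 U1] T1 U1 TU(3) W_def by auto
    next
      case False
      have sub: "W \<subseteq> F \<inter> G"
        using TF(1) T1(1,2) U1(1,2) W_def by blast
      have int: "(F \<inter> G) face_of P"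
        using F_face(1) T1(1) U1(1) face_of_Int by blast
      have GP: "G \<subseteq> P" "F \<subseteq> P"
        using F_face(1) U1(1) T1(1) face_of_imp_subset by blast+
      \<comment> \<open>Equality would make \<open>F\<close> a proper face of \<open>G\<close>,
        although both have dimension \<open>k\<close>.\<close>
      have "F \<inter> G \<noteq> F"
      proof
        assume eq: "F \<inter> G = F"
        then have "F face_of G"
          using int GP by (metis face_of_subset inf.cobounded2)
        then have "aff_dim F < aff_dim G"
          using face_of_aff_dim_lt False F_face(4) U1(1) by blast
        then show False
          using F_face(2) T1(1) U1(1) by simp
      qed
      then have "aff_dim (F \<inter> G) < aff_dim F"
        using face_of_subset[OF int _ GP(2)] F_face(4)[OF T1(1)] by (simp add: face_of_aff_dim_lt)
      then show ?thesis
        using aff_dim_subset[OF sub] F_face(2)[OF T1(1)] by simp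
    qed
    \<comment> \<open>A common point of two cones comes with base points \<open>y\<close> and
      \<open>y'\<close> on one ray from \<open>a\<close>. If \<open>y'\<close> were strictly closer
      to \<open>a\<close>, it would lie in the open segment from \<open>a\<close> to
      \<open>y\<close>, and the face \<open>G\<close> would have to contain \<open>a\<close>. So the
      base points agree.\<close>
    have key: "y \<in> convex hull U1"
      if "y \<in> F" "y' \<in> G" "u \<ge> 0" "v > 0" "u + v = 1" "u' \<ge> 0" "v' \<ge> v" "u' + v' = 1"
        "u *\<^sub>R a + v *\<^sub>R y = u' *\<^sub>R a + v' *\<^sub>R y'" "y' \<in> convex hull U1" "F \<in> \<F>" "G \<in> \<F>"
      for y y' u v u' v' F G U1
    proof (cases "v = v'")
      case True
      with that have "u = u'" by simp
      with True that(4,9) have "y = y'" by simp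
      with that show ?thesis by simp
    next
      case False
      with that have lt: "v < v'" by simp
      have "v' *\<^sub>R y' = (v' - v) *\<^sub>R a + v *\<^sub>R y"
      proof -
        have u: "u = 1 - v" "u' = 1 - v'"
          using that by simp_all
        show ?thesis
          using that(9) unfolding u by (simp add: algebra_simps)
      qed
      then have "(1 / v') *\<^sub>R (v' *\<^sub>R y') = (1 / v') *\<^sub>R ((v' - v) *\<^sub>R a + v *\<^sub>R y)"
        by simp
      then have y': "y' = (1 - v / v') *\<^sub>R a + (v / v') *\<^sub>R y"
        using lt that(4) by (simp add: scaleR_add_right diff_divide_distrib)
      have "a \<noteq> y"
        using that F_face(3) by blast
      then have "y' \<in> open_segment a y"
        using y' lt that(4) by (auto simp: in_segment intro!: exI[of _ "v / v'"])
      moreover have "y \<in> P"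
        using F_face(1) that(1,11) face_of_imp_subset by blast
      ultimately have "a \<in> G"
        using face_ofD[OF F_face(1)[OF that(12)], of y' a y] that(2) aP by blast
      then show ?thesis
        using F_face(3) that(12) by blast
    qed
    have "convex hull T \<inter> convex hull U \<subseteq> affine hull (insert a W)"
    proof
      fix x assume x: "x \<in> convex hull T \<inter> convex hull U"
      obtain u v y where y: "u \<ge> 0" "v \<ge> 0" "u + v = 1" "y \<in> convex hull T1" "x = u *\<^sub>R a + v *\<^sub>R y"
        using x T1(3) convex_hull_insert[OF TF(3)[OF T1(1,2)], of a] by auto
      obtain u' v' y' where y': "u' \<ge> 0" "v' \<ge> 0" "u' + v' = 1" "y' \<in> convex hull U1" "x = u' *\<^sub>R a + v' *\<^sub>R y'"
        using x U1(3) convex_hull_insert[OF TF(3)[OF U1(1,2)], of a] by auto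
      have yF: "y \<in> F" "y' \<in> G"
        using TF(1) y(4) y'(4) T1 U1 by blast+
      have W_case: "x \<in> affine hull (insert a W)" if "z \<in> W" "x = s *\<^sub>R a + r *\<^sub>R z" "s + r = 1" for z s r
        using that by (simp add: mem_affine affine_affine_hull hull_inc)
      show "x \<in> affine hull (insert a W)"
      proof (cases "v = 0 \<or> v' = 0")
        case True
        then have "x = a"
          using y y' by auto
        then show ?thesis
          by (simp add: hull_inc)
      next
        case False
        then have pos: "v > 0" "v' > 0"
          using y(2) y'(2) by auto
        show ?thesis
        proof (cases "v \<le> v'")
          case True
          have "y \<in> convex hull U1"
            using y'(5) by (intro key[of y F y' G u v u' v']) (use y y' yF pos True T1 U1 in auto)
          then show ?thesis
            using y by (intro W_case[of y u v]) (auto simp: W_def)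
        next
          case False
          have "y' \<in> convex hull T1"
            using y(5) y'(5) by (intro key[of y' G y F u' v' u v]) (use y y' yF pos False T1 U1 in auto)
          then show ?thesis
            using y' by (intro W_case[of y' u' v']) (auto simp: W_def)
        qed
      qed
    qed
    then have "aff_dim (convex hull T \<inter> convex hull U) \<le> aff_dim (insert a W)"
      by (metis aff_dim_affine_hull aff_dim_subset)
    also have "\<dots> \<le> aff_dim W + 1"
      by (simp add: aff_dim_insert)
    finally show ?thesis
      using \<open>aff_dim W < int k\<close> by simp
  qed
  ultimately show ?case
    unfolding P_def triangulates_def by (intro exI[of _ \<T>]) blast
qed

section \<open>Volumes of convex hulls\<close>

text \<open>The library version of this fact requires the index type to be well-ordered.\<close>

lemma measure_linear_image_vec:
  fixes f :: "real^'n \<Rightarrow> real^'n"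
  assumes "linear f" "S \<in> lmeasurable"
  shows "f ` S \<in> lmeasurable \<and> measure lebesgue (f ` S) = \<bar>det (matrix f)\<bar> * measure lebesgue S"
proof -
  let ?P = "\<lambda>f :: real^'n \<Rightarrow> real^'n. \<forall>S\<in>lmeasurable. f ` S \<in> lmeasurable \<and>
     measure lebesgue (f ` S) = \<bar>det (matrix f)\<bar> * measure lebesgue S"
  have "?P f"
  proof (rule induct_linear_elementary[OF \<open>linear f\<close>])
    fix f g :: "real^'n \<Rightarrow> real^'n"
    assume "linear f" "linear g" "?P f" "?P g"
    then show "?P (f \<circ> g)"
      by (simp add: matrix_compose det_mul abs_mult image_comp[symmetric] del: o_apply)
  next
    fix f :: "real^'n \<Rightarrow> real^'n" and i
    assume f: "linear f" "\<And>x. f x $ i = 0"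
    then have ninj: "\<not> inj f"
      by (metis linear_injective_imp_surjective one_neq_zero surjE vec_component)
    show "?P f"
    proof
      fix S :: "(real^'n) set"
      have "negligible (f ` S)"
        using negligible_linear_singular_image[OF f(1) ninj] .
      moreover have "det (matrix f) = 0"
        using det_nz_iff_inj[OF f(1)] ninj by blast
      ultimately show "f ` S \<in> lmeasurable \<and> measure lebesgue (f ` S) = \<bar>det (matrix f)\<bar> * measure lebesgue S"
        by (simp add: negligible_iff_measure)
    qed
  next
    fix c :: "'n \<Rightarrow> real"
    show "?P (\<lambda>x. \<chi> i. c i * x $ i)"
      by (simp add: measurable_stretch measure_stretch matrix_def axis_def det_diagonal)
  next
    fix m n :: 'n
    assume "m \<noteq> n"
    define h :: "real^'n \<Rightarrow> real^'n" where "h = (\<lambda>x. \<chi> i. x $ Transposition.transpose m n i)"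
    have lin: "linear h"
      by (rule linearI) (simp_all add: h_def vec_eq_iff)
    have hh: "h (h x) = x" for x
      by (simp add: h_def vec_eq_iff)
    have perm: "Transposition.transpose m n permutes UNIV"
      by (simp add: permutes_swap_id)
    have "matrix h = (\<chi> i. mat 1 $ Transposition.transpose m n i)"
      by (auto simp: matrix_def h_def vec_eq_iff axis_def mat_def)
    then have det: "\<bar>det (matrix h)\<bar> = 1"
      using det_permute_rows[OF perm, of "mat 1 :: real^'n^'n"] \<open>m \<noteq> n\<close> by (simp add: sign_swap_id)
    \<comment> \<open>For an elementary linear map it suffices to know the volumes of the images of
      boxes. A swap of two coordinates sends boxes to boxes with the same side lengths.\<close>
    have box: "h ` cbox a b = cbox (h a) (h b)" for a b
    proof -
      have *: "x \<in> cbox a b \<longleftrightarrow> h x \<in> cbox (h a) (h b)" for x a b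
        by (auto simp: mem_box_cart h_def) (metis transpose_involutory)+
      show ?thesis
      proof (intro equalityI subsetI)
        fix x assume "x \<in> cbox (h a) (h b)"
        then have "h x \<in> cbox a b"
          using *[of x "h a" "h b"] by (simp add: hh)
        then show "x \<in> h ` cbox a b"
          by (metis hh imageI)
      qed (use * in blast)
    qed
    have "measure lebesgue (h ` cbox a b) = 1 * measure lebesgue (cbox a b)" for a b
    proof (cases "cbox a b = {}")
      case False
      then have ne: "h ` cbox a b \<noteq> {}"
        by simp
      have "(\<Prod>i\<in>UNIV. (h b - h a) $ i) = (\<Prod>i\<in>UNIV. (b - a) $ i)"
        using prod.permute[OF perm, of "\<lambda>i. (b - a) $ i"] by (simp add: h_def o_def)
      then show ?thesis
        using False ne by (simp add: box content_cbox_cart)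
    qed simp
    then have "?P h"
      using measure_linear_sufficient[OF lin] det by (metis mult_1)
    then show "?P (\<lambda>x. \<chi> i. x $ Transposition.transpose m n i)"
      by (simp add: h_def)
  next
    fix m n :: 'n
    assume mn: "m \<noteq> n"
    define h :: "real^'n \<Rightarrow> real^'n" where "h = (\<lambda>x. \<chi> i. if i = m then x $ m + x $ n else x $ i)"
    have lin: "linear h"
      by (rule linearI) (auto simp: h_def vec_eq_iff algebra_simps)
    have "matrix h = (\<chi> k. if k = m then row m (mat 1) + 1 *s row n (mat 1) else row k (mat 1))"
      by (auto simp: matrix_def h_def vec_eq_iff axis_def mat_def row_def)
    then have det: "det (matrix h) = 1"
      using det_row_operation[OF mn, of "mat 1 :: real^'n^'n" 1] by simp
    have "measure lebesgue (h ` cbox a b) = 1 * measure lebesgue (cbox a b)" for a b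
    proof (cases "cbox a b = {}")
      case False
      \<comment> \<open>The shear formula is applied to a box whose lower corner has a nonnegative
        \<open>n\<close>-th coordinate. Translating by \<open>v\<close> makes this coordinate
        \<open>0\<close>, and by linearity only translates the image.\<close>
      define v :: "real^'n" where "v = axis n (a $ n)"
      have ne: "cbox (a - v) (b - v) \<noteq> {}" and v: "0 \<le> (a - v) $ n"
        using False by (auto simp: interval_ne_empty_cart v_def axis_def)
      have eq: "cbox a b = (+) v ` cbox (a - v) (b - v)"
        by (simp add: cbox_translation[symmetric])
      then have "h ` cbox a b = (+) (h v) ` h ` cbox (a - v) (b - v)"
        by (simp add: image_comp o_def linear_add[OF lin])
      then have "measure lebesgue (h ` cbox a b) = measure lebesgue (h ` cbox (a - v) (b - v))"
        by (simp only: measure_translation)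
      also have "\<dots> = measure lebesgue (cbox (a - v) (b - v))"
        using measure_shear_interval[OF mn ne v] by (simp add: h_def)
      also have "\<dots> = measure lebesgue (cbox a b)"
        by (simp only: eq measure_translation)
      finally show ?thesis
        by simp
    qed simp
    then have "?P h"
      using measure_linear_sufficient[OF lin] det by (metis abs_one mult_1)
    then show "?P (\<lambda>x. \<chi> i. if i = m then x $ m + x $ n else x $ i)"
      by (simp add: h_def)
  qed
  then show ?thesis
    using assms(2) by blast
qed

text \<open>The hull is an affine image of the standard simplex, whose volume is
  \<open>1 / fact CARD('d)\<close>; the index \<open>None\<close> marks the vertex from which the
  edges are taken. Affinely dependent points are included, both sides being zero.\<close>

lemma measure_simplex_vec:
  fixes p :: "'d::finite option \<Rightarrow> real^'d"
  shows "measure lebesgue (convex hull (range p)) = \<bar>det (\<chi> i k. p (Some k) $ i - p None $ i)\<bar> / fact CARD('d)"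
proof -
  define A :: "real^'d^'d" where "A = (\<chi> i k. p (Some k) $ i - p None $ i)"
  define \<Delta> :: "(real^'d) set" where "\<Delta> = convex hull (insert 0 Basis)"
  have comp: "compact \<Delta>"
    unfolding \<Delta>_def by (intro finite_imp_compact_convex_hull) auto
  have col: "A *v axis k 1 = p (Some k) - p None" for k
    by (simp add: A_def matrix_vector_mult_basis column_def vec_eq_iff)
  have "range p = (+) (p None) ` (*v) A ` insert 0 Basis"
  proof -
    have "range p = insert (p None) (range (\<lambda>k. p (Some k)))"
      by (auto simp: UNIV_option_conv)
    also have "range (\<lambda>k. p (Some k)) = (\<lambda>x. p None + A *v x) ` Basis"
      by (auto simp: Basis_vec_def col image_iff)
    finally show ?thesis
      by (simp add: image_image)
  qed
  then have "convex hull (range p) = (+) (p None) ` (*v) A ` \<Delta>"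
    by (simp only: \<Delta>_def convex_hull_linear_image[OF matrix_vector_mul_linear] convex_hull_translation)
  then have "measure lebesgue (convex hull (range p)) = measure lebesgue ((*v) A ` \<Delta>)"
    by (simp only: measure_translation)
  also have "\<dots> = \<bar>det A\<bar> * measure lebesgue \<Delta>"
    using measure_linear_image_vec[of "(*v) A" \<Delta>] comp by (simp add: lmeasurable_compact)
  also have "measure lebesgue \<Delta> = 1 / fact CARD('d)"
    using content_std_simplex[where 'a="real^'d"] comp
    by (simp add: \<Delta>_def measure_completion compact_imp_closed)
  finally show ?thesis
    by (simp add: A_def)
qed

text \<open>Naming the simplices of a triangulation by maps into the index type \<open>'m\<close>,
  rather than by their points, leaves only finitely many families \<open>E\<close>, whatever the
  points \<open>p\<close> are. A hull of lower dimension gets the empty family.\<close>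

lemma measure_convex_hull_simplices:
  fixes p :: "'m::finite \<Rightarrow> real^'d"
  shows "\<exists>E :: ('d option \<Rightarrow> 'm) set. measure lebesgue (convex hull (range p)) =
     (\<Sum>e\<in>E. measure lebesgue (convex hull (range (p \<circ> e))))"
proof (cases "aff_dim (range p) = int CARD('d)")
  case False
  have "aff_dim (convex hull (range p)) \<noteq> int DIM(real^'d)"
    using False by (simp add: aff_dim_convex_hull)
  then have "interior (convex hull (range p)) = {}"
    using aff_dim_nonempty_interior by blast
  then have "negligible (convex hull (range p))"
    by (simp add: negligible_convex_interior)
  then show ?thesis
    by (intro exI[of _ "{}"]) (simp add: negligible_imp_measure0)
next
  case True
  then obtain \<T> where T: "triangulates \<T> CARD('d) (range p) (convex hull (range p))"
    using triangulates_exists[of "range p" "CARD('d)"] by auto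
  then have sub: "T \<subseteq> range p" "card T = Suc CARD('d)" if "T \<in> \<T>" for T
    using that by (simp_all add: triangulates_def)
  have "\<exists>e. p ` e ` (UNIV :: 'd option set) = T" if "T \<in> \<T>" for T
  proof -
    have "card (UNIV :: 'd option set) = card T" "finite T"
      using sub[OF that] by (auto simp: card_UNIV_option card_ge_0_finite)
    then obtain h where h: "bij_betw h (UNIV :: 'd option set) T"
      using finite_same_card_bij[of "UNIV :: 'd option set" T] by auto
    then have "p (inv p (h x)) = h x" for x
      using sub(1)[OF that] by (metis UNIV_I bij_betwE f_inv_into_f subsetD)
    then have "p ` (inv p \<circ> h) ` UNIV = T"
      using h by (simp add: image_image bij_betw_def)
    then show ?thesis by blast
  qed
  then obtain e where e: "\<And>T. T \<in> \<T> \<Longrightarrow> p ` e T ` (UNIV :: 'd option set) = T"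
    by metis
  have inj: "inj_on e \<T>"
    by (rule inj_onI) (metis e)
  have "finite \<T>"
    using sub(1) by (intro finite_subset[of \<T> "Pow (range p)"]) auto
  have "measure lebesgue (\<Union>T\<in>\<T>. convex hull T) = (\<Sum>T\<in>\<T>. measure lebesgue (convex hull T))"
  proof (rule measure_negligible_finite_Union_image[OF \<open>finite \<T>\<close>])
    fix T assume "T \<in> \<T>"
    then have "finite T"
      using sub(2) by (simp add: card_ge_0_finite)
    then show "convex hull T \<in> lmeasurable"
      by (simp add: finite_imp_compact_convex_hull lmeasurable_compact)
  next
    show "pairwise (\<lambda>T U. negligible (convex hull T \<inter> convex hull U)) \<T>"
    proof (rule pairwiseI)
      fix T U assume "T \<in> \<T>" "U \<in> \<T>" "T \<noteq> U"
      then have "aff_dim (convex hull T \<inter> convex hull U) < int DIM(real^'d)"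
        using T by (simp add: triangulates_def)
      then have "interior (convex hull T \<inter> convex hull U) = {}"
        using aff_dim_nonempty_interior by fastforce
      then show "negligible (convex hull T \<inter> convex hull U)"
        by (simp add: negligible_convex_interior convex_Int)
    qed
  qed
  also have "(\<Union>T\<in>\<T>. convex hull T) = convex hull (range p)"
    using T by (simp add: triangulates_def)
  also have "(\<Sum>T\<in>\<T>. measure lebesgue (convex hull T)) = (\<Sum>T\<in>\<T>. measure lebesgue (convex hull (range (p \<circ> e T))))"
    by (intro sum.cong refl) (metis e image_comp)
  also have "\<dots> = (\<Sum>e\<in>e ` \<T>. measure lebesgue (convex hull (range (p \<circ> e))))"
    by (simp add: sum.reindex[OF inj])
  finally show ?thesis
    by blast
qed

text \<open>Interior points of the limit hull eventually belong to the hulls, and points outside it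
  eventually do not. The frontier of a convex set is negligible, so the indicator functions converge
  almost everywhere, dominated by that of a ball.\<close>

lemma tendsto_measure_convex_hull:
  fixes p :: "nat \<Rightarrow> 'm::finite \<Rightarrow> 'a::euclidean_space"
  assumes lim: "\<And>j. (\<lambda>n. p n j) \<longlonglongrightarrow> q j"
  shows "(\<lambda>n. measure lebesgue (convex hull (range (p n)))) \<longlonglongrightarrow> measure lebesgue (convex hull (range q))"
proof -
  define K where "K = (\<lambda>n. convex hull (range (p n)))"
  define L where "L = convex hull (range q)"
  have compK: "compact (K n)" and compL: "compact L" for n
    by (auto simp: K_def L_def finite_imp_compact_convex_hull)
  have inner: "\<forall>\<^sub>F n in sequentially. x \<in> K n" if x: "x \<in> interior L" for x
  proof -
    obtain r where r: "r > 0" "cball x r \<subseteq> L"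
      using x by (meson mem_interior_cball)
    have "\<forall>\<^sub>F n in sequentially. \<forall>j. dist (p n j) (q j) < r"
      using r(1) lim tendstoD by (intro eventually_all_finite) blast
    then show ?thesis
    proof eventually_elim
      case (elim n)
      show "x \<in> K n"
      proof (rule ccontr)
        assume "x \<notin> K n"
        then obtain a b where ab: "a \<bullet> x < b" "\<And>y. y \<in> K n \<Longrightarrow> b < a \<bullet> y"
          using separating_hyperplane_closed_point[of "K n" x] compK
          by (auto simp: K_def compact_imp_closed)
        have "a \<noteq> 0"
          using ab(1) ab(2)[of "p n undefined"] by (auto simp: K_def hull_inc)
        \<comment> \<open>The points \<open>q j\<close> are within \<open>r\<close> of
          \<open>K n\<close>, so shifting the separating half-space by \<open>r\<close> captures all
          of \<open>L\<close>. But the point of \<open>cball x r\<close> that is extreme in the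
          direction \<open>- a\<close> lies on the boundary of the shifted half-space.\<close>
        have "a \<bullet> x - r * norm a < a \<bullet> q j" for j
        proof -
          have "a \<bullet> x < a \<bullet> p n j"
            using ab(1) ab(2)[of "p n j"] by (simp add: K_def hull_inc)
          moreover have "a \<bullet> (p n j - q j) \<le> norm a * norm (p n j - q j)"
            by (rule norm_cauchy_schwarz)
          moreover have "norm a * norm (p n j - q j) < norm a * r"
            using elim \<open>a \<noteq> 0\<close> by (simp add: dist_norm)
          ultimately show ?thesis
            by (simp add: inner_diff_right algebra_simps)
        qed
        then have "L \<subseteq> {y. a \<bullet> y > a \<bullet> x - r * norm a}"
          unfolding L_def by (intro hull_minimal convex_halfspace_gt) auto
        moreover have "x - (r / norm a) *\<^sub>R a \<in> cball x r"
          using \<open>a \<noteq> 0\<close> r(1) by (simp add: dist_norm)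
        ultimately have "a \<bullet> (x - (r / norm a) *\<^sub>R a) > a \<bullet> x - r * norm a"
          using r(2) by blast
        moreover have "a \<bullet> (x - (r / norm a) *\<^sub>R a) = a \<bullet> x - r * norm a"
          using \<open>a \<noteq> 0\<close> by (simp add: inner_diff_right dot_square_norm power2_eq_square)
        ultimately show False
          by simp
      qed
    qed
  qed
  have outer: "\<forall>\<^sub>F n in sequentially. x \<notin> K n" if x: "x \<notin> L" for x
  proof -
    obtain a b where ab: "a \<bullet> x < b" "\<And>y. y \<in> L \<Longrightarrow> b < a \<bullet> y"
      using separating_hyperplane_closed_point[of L x] compL x by (auto simp: L_def compact_imp_closed)
    have "\<forall>\<^sub>F n in sequentially. b < a \<bullet> p n j" for j
      using ab(2)[of "q j"] lim by (intro order_tendstoD(1)[of _ "a \<bullet> q j"] tendsto_intros) (auto simp: L_def hull_inc)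
    then have "\<forall>\<^sub>F n in sequentially. \<forall>j. b < a \<bullet> p n j"
      by (rule eventually_all_finite)
    then show ?thesis
    proof eventually_elim
      case (elim n)
      then have "K n \<subseteq> {y. a \<bullet> y > b}"
        unfolding K_def by (intro hull_minimal convex_halfspace_gt) auto
      with ab(1) show ?case
        by auto
    qed
  qed
  have "\<exists>B. \<forall>n. norm (p n j) \<le> B" for j
    using convergent_imp_Bseq[OF convergentI[OF lim[of j]]] unfolding Bseq_def by blast
  then obtain B where B: "\<And>n j. norm (p n j) \<le> B j"
    by metis
  define C where "C = Max (range B)"
  have "p n j \<in> cball 0 C" for n j
    using order_trans[OF B, of j C n] by (simp add: C_def)
  then have KC: "K n \<subseteq> cball 0 C" for n
    unfolding K_def by (intro hull_minimal convex_cball) auto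
  have "(\<lambda>n. integral\<^sup>L lebesgue (indicat_real (K n))) \<longlonglongrightarrow> integral\<^sup>L lebesgue (indicat_real L)"
  proof (rule integral_dominated_convergence[where w = "indicat_real (cball 0 C)"])
    show "indicat_real L \<in> borel_measurable lebesgue" "indicat_real (K n) \<in> borel_measurable lebesgue" for n
      using compK compL by (auto intro!: borel_measurable_indicator lmeasurable_compact fmeasurableD)
    show "integrable lebesgue (indicat_real (cball 0 C))"
      using lmeasurable_cball[of 0 C] by (auto simp: fmeasurable_def)
    have "negligible (frontier L)"
      by (simp add: L_def negligible_convex_frontier)
    then have "AE x in lebesgue. x \<notin> frontier L"
      by (intro AE_not_in) (simp add: negligible_iff_null_sets)
    then show "AE x in lebesgue. (\<lambda>n. indicat_real (K n) x) \<longlonglongrightarrow> indicat_real L x"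
    proof eventually_elim
      case (elim x)
      then have "x \<in> interior L \<or> x \<notin> L"
        using compL by (auto simp: frontier_def compact_imp_closed)
      then have "\<forall>\<^sub>F n in sequentially. indicat_real (K n) x = indicat_real L x"
      proof
        assume x: "x \<in> interior L"
        then have "x \<in> L"
          using interior_subset by blast
        show ?thesis
          using inner[OF x] by eventually_elim (simp add: \<open>x \<in> L\<close>)
      next
        assume x: "x \<notin> L"
        show ?thesis
          using outer[OF x] by eventually_elim (simp add: x)
      qed
      then show ?case
        by (rule tendsto_eventually)
    qed
    show "AE x in lebesgue. norm (indicat_real (K n) x) \<le> indicat_real (cball 0 C) x" for n
      using KC[of n] by (intro AE_I2) (auto simp: indicator_def)
  qed
  then show ?thesis
    by (simp add: K_def L_def)
qed

text \<open>
  Distinct polynomials are eventually nowhere equal, so a continuous function cannot switch between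
  finitely many of them.
\<close>

lemma eventually_poly_of_finite_choice:
  fixes f :: "real \<Rightarrow> real"
  assumes cont: "continuous_on {a..} f" and fin: "finite Q"
    and val: "\<And>t. t \<ge> a \<Longrightarrow> \<exists>q\<in>Q. f t = poly q t"
  shows "\<exists>q\<in>Q. \<forall>\<^sub>F t in at_top. f t = poly q t"
proof -
  have sep: "\<forall>\<^sub>F t in at_top. poly q t \<noteq> poly q' t" if "q \<noteq> q'" for q q' :: "real poly"
  proof -
    have "finite {t. poly (q - q') t = 0}"
      using that by (intro poly_roots_finite) simp
    then have "\<forall>\<^sub>F t in at_top. \<forall>x\<in>{t. poly (q - q') t = 0}. t \<noteq> x"
      by (intro eventually_ball_finite) (auto intro: eventually_at_top_not_equal)
    then show ?thesis
      by eventually_elim auto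
  qed
  then have "\<forall>\<^sub>F t in at_top. q \<noteq> q' \<longrightarrow> poly q t \<noteq> poly q' t" for q q' :: "real poly"
    by (cases "q = q'") auto
  then have "\<forall>\<^sub>F t in at_top. \<forall>q\<in>Q. \<forall>q'\<in>Q. q \<noteq> q' \<longrightarrow> poly q t \<noteq> poly q' t"
    by (intro eventually_ball_finite fin ballI)
  then obtain c where c: "\<And>t q q'. t \<ge> c \<Longrightarrow> q \<in> Q \<Longrightarrow> q' \<in> Q \<Longrightarrow> q \<noteq> q' \<Longrightarrow> poly q t \<noteq> poly q' t"
    unfolding eventually_at_top_linorder by blast
  define b where "b = max a c"
  have cont_b: "continuous_on {b..} f"
    using cont by (rule continuous_on_subset) (auto simp: b_def)
  obtain q where q: "q \<in> Q" "f b = poly q b"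
    using val[of b] by (auto simp: b_def)
  \<comment> \<open>The sets \<open>Z q\<close> on which \<open>f\<close> agrees with
    \<open>q\<close> are closed, pairwise disjoint for \<open>q\<close> in \<open>Q\<close>, and
    cover the connected set \<open>{b..}\<close>. Hence the one containing \<open>b\<close> is
    everything.\<close>
  define Z where "Z = (\<lambda>q. {b..} \<inter> (\<lambda>t. f t - poly q t) -` {0})"
  have clZ: "closed (Z q)" for q
    unfolding Z_def by (intro continuous_closed_preimage continuous_intros cont_b)
  have "Z q \<inter> {b..} = {} \<or> (\<Union>q'\<in>Q - {q}. Z q') \<inter> {b..} = {}"
  proof (rule connected_closedD)
    show "connected {b..}"
      by (simp add: is_interval_connected)
    show "Z q \<inter> (\<Union>q'\<in>Q - {q}. Z q') \<inter> {b..} = {}"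
      using c q(1) by (auto simp: Z_def b_def) metis
    show "{b..} \<subseteq> Z q \<union> (\<Union>q'\<in>Q - {q}. Z q')"
      using val by (fastforce simp: Z_def b_def)
    show "closed (\<Union>q'\<in>Q - {q}. Z q')"
      using fin clZ by (intro closed_UN) auto
  qed (rule clZ)
  moreover have "b \<in> Z q"
    using q(2) by (simp add: Z_def)
  ultimately have "(\<Union>q'\<in>Q - {q}. Z q') \<inter> {b..} = {}"
    by (auto simp: Z_def)
  then have "f t = poly q t" if "t \<ge> b" for t
    using val[of t] that by (fastforce simp: Z_def b_def)
  then show ?thesis
    using q(1) eventually_ge_at_top[of b] by (metis (mono_tags, lifting) eventually_mono)
qed

lemma poly_det:
  fixes A :: "'a::comm_ring_1 poly^'n^'n"
  shows "poly (det A) x = det (\<chi> i j. poly (A $ i $ j) x)"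
  by (simp add: det_def poly_sum poly_prod)

text \<open>The absolute value is continuous and takes at each point the value of \<open>p\<close>
  or of \<open>- p\<close>.\<close>

lemma eventually_abs_poly:
  fixes p :: "real poly"
  shows "\<exists>q. \<forall>\<^sub>F t in at_top. \<bar>poly p t\<bar> = poly q t"
proof -
  have "\<exists>q\<in>{p, - p}. \<forall>\<^sub>F t in at_top. \<bar>poly p t\<bar> = poly q t"
  proof (rule eventually_poly_of_finite_choice[where a = 0])
    show "continuous_on {0..} (\<lambda>t. \<bar>poly p t\<bar>)"
      by (intro continuous_intros)
  qed (auto simp: abs_if)
  then show ?thesis
    by blast
qed

text \<open>Each simplex volume is the absolute value of a determinant polynomial, up to a constant
  factor, hence eventually a polynomial \<open>s e\<close>. The family \<open>E\<close> may vary
  with \<open>t\<close>, but there are finitely many sums over such families, and continuity of the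
  volume in \<open>t\<close> singles out one of them.\<close>

lemma eventually_poly_measure_convex_hull:
  fixes p :: "'m::finite \<Rightarrow> 'd::finite \<Rightarrow> real poly"
  shows "\<exists>q. \<forall>\<^sub>F t in at_top.
     measure lebesgue (convex hull (range (\<lambda>j. \<chi> i. poly (p j i) t))) = poly q t"
proof -
  define v :: "real \<Rightarrow> 'm \<Rightarrow> real^'d" where "v = (\<lambda>t j. \<chi> i. poly (p j i) t)"
  define f where "f = (\<lambda>t. measure lebesgue (convex hull (range (v t))))"
  define D where "D = (\<lambda>e :: 'd option \<Rightarrow> 'm. det (\<chi> i k. p (e (Some k)) i - p (e None) i))"
  have D: "measure lebesgue (convex hull (range (v t \<circ> e))) = \<bar>poly (D e) t\<bar> / fact CARD('d)" for t e
    by (simp add: measure_simplex_vec D_def poly_det v_def)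
  obtain s where s: "\<And>e. \<forall>\<^sub>F t in at_top. \<bar>poly (D e) t\<bar> = poly (s e) t"
    using choice[of "\<lambda>e q. \<forall>\<^sub>F t in at_top. \<bar>poly (D e) t\<bar> = poly q t"] eventually_abs_poly by blast
  then have "\<forall>\<^sub>F t in at_top. \<forall>e. \<bar>poly (D e) t\<bar> = poly (s e) t"
    by (rule eventually_all_finite)
  then obtain a where a: "\<And>t e. t \<ge> a \<Longrightarrow> \<bar>poly (D e) t\<bar> = poly (s e) t"
    unfolding eventually_at_top_linorder by blast
  have "\<exists>q\<in>range (\<lambda>E. \<Sum>e\<in>E. smult (1 / fact CARD('d)) (s e)). \<forall>\<^sub>F t in at_top. f t = poly q t"
  proof (rule eventually_poly_of_finite_choice)
    show "continuous_on {a..} f"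
      unfolding continuous_on_sequentially
    proof (intro allI ballI impI, elim conjE)
      fix x :: "nat \<Rightarrow> real" and t
      assume "x \<longlonglongrightarrow> t"
      then have "(\<lambda>n. v (x n) j) \<longlonglongrightarrow> v t j" for j
        unfolding v_def by (intro vec_tendstoI) (auto intro: tendsto_poly)
      then show "(f \<circ> x) \<longlonglongrightarrow> f t"
        unfolding f_def comp_def by (rule tendsto_measure_convex_hull)
    qed
    show "\<exists>q\<in>range (\<lambda>E. \<Sum>e\<in>E. smult (1 / fact CARD('d)) (s e)). f t = poly q t" if "t \<ge> a" for t
    proof -
      obtain E :: "('d option \<Rightarrow> 'm) set" where
        E: "f t = (\<Sum>e\<in>E. measure lebesgue (convex hull (range (v t \<circ> e))))"
        unfolding f_def using measure_convex_hull_simplices[of "v t"] by (elim exE)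
      have "f t = poly (\<Sum>e\<in>E. smult (1 / fact CARD('d)) (s e)) t"
        unfolding E D a[OF that] by (simp add: poly_sum)
      then show ?thesis
        by (intro bexI[of _ "\<Sum>e\<in>E. smult (1 / fact CARD('d)) (s e)"]) auto
    qed
  qed auto
  then show ?thesis
    unfolding f_def v_def by (elim bexE) (rule exI)
qed

section \<open>Vertices of tropical polytopes\<close>

text \<open>Arbitrary index sets allow nested combinations to be indexed by pairs, without the
  renumbering that \<open>tconv\<close> would require.\<close>

definition tcomb :: "'j set \<Rightarrow> ('j \<Rightarrow> ereal) \<Rightarrow> ('j \<Rightarrow> ereal^'d) \<Rightarrow> ereal^'d" where
  "tcomb I l v = (\<chi> i. SUP j\<in>I. l j + v j $ i)"

lemma finite_SUP_attained:
  fixes f :: "'j \<Rightarrow> ereal"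
  assumes "finite I" "I \<noteq> {}"
  obtains j where "j \<in> I" "(SUP j\<in>I. f j) = f j"
proof -
  have "Sup (f ` I) \<in> f ` I"
    using assms Max_in[of "f ` I"] by (simp add: Max_Sup)
  then show thesis
    using that by blast
qed

lemma SUP_add_finite:
  fixes f :: "'j \<Rightarrow> ereal"
  assumes "finite I" "I \<noteq> {}"
  shows "c + (SUP j\<in>I. f j) = (SUP j\<in>I. c + f j)"
proof (rule antisym)
  obtain j where "j \<in> I" "(SUP j\<in>I. f j) = f j"
    using finite_SUP_attained assms .
  then show "c + (SUP j\<in>I. f j) \<le> (SUP j\<in>I. c + f j)"
    by (auto intro: SUP_upper)
qed (auto intro!: SUP_least add_left_mono SUP_upper)

lemma SUP_eq_0_ereal:
  fixes l :: "'j \<Rightarrow> ereal"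
  assumes "finite I"
  shows "(SUP j\<in>I. l j) = 0 \<longleftrightarrow> (\<forall>j\<in>I. l j \<le> 0) \<and> (\<exists>j\<in>I. l j = 0)"
proof
  assume 0: "(SUP j\<in>I. l j) = 0"
  then have "I \<noteq> {}"
    by (auto simp: bot_ereal_def)
  then obtain j where "j \<in> I" "(SUP j\<in>I. l j) = l j"
    using finite_SUP_attained assms by metis
  with 0 show "(\<forall>j\<in>I. l j \<le> 0) \<and> (\<exists>j\<in>I. l j = 0)"
    by (metis SUP_upper)
next
  assume "(\<forall>j\<in>I. l j \<le> 0) \<and> (\<exists>j\<in>I. l j = 0)"
  then show "(SUP j\<in>I. l j) = 0"
    by (metis SUP_least SUP_upper antisym)
qed

lemma tcomb_in_tconv:
  fixes l :: "'j \<Rightarrow> ereal"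
  assumes "finite I" "\<And>j. j \<in> I \<Longrightarrow> l j \<le> 0" "\<And>j. j \<in> I \<Longrightarrow> v j \<in> V" "\<exists>j\<in>I. l j = 0"
  shows "tcomb I l v \<in> tconv V"
proof -
  obtain h where h: "bij_betw h {..<card I} I"
    using ex_bij_betw_nat_finite[OF assms(1)] by (auto simp: atLeast0LessThan)
  then have im: "(SUP j\<in>I. f j) = (SUP k\<in>{..<card I}. f (h k))" for f :: "'j \<Rightarrow> ereal"
    unfolding bij_betw_def by (metis image_image)
  have "h k \<in> I" if "k < card I" for k
    using h that by (auto simp: bij_betw_def)
  moreover have "(SUP k\<in>{..<card I}. l (h k)) = 0"
    using assms by (simp add: im[symmetric] SUP_eq_0_ereal)
  ultimately show ?thesis
    unfolding tconv_def tcomb_def mem_Collect_eq im using assms(2,3)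
    by (intro exI[of _ "card I"] exI[of _ "l \<circ> h"] exI[of _ "v \<circ> h"]) force
qed

lemma tconvE:
  assumes "x \<in> tconv V"
  obtains n :: nat and l v where "x = tcomb {..<n} l v" "\<And>j. j < n \<Longrightarrow> l j \<le> 0"
    "\<And>j. j < n \<Longrightarrow> v j \<in> V" "\<exists>j<n. l j = 0"
proof -
  obtain n :: nat and l v where "\<forall>j<n. l j \<noteq> \<infinity> \<and> v j \<in> V" "(SUP j\<in>{..<n}. l j) = 0" "x = tcomb {..<n} l v"
    using assms unfolding tconv_def tcomb_def by blast
  then show thesis
    by (intro that[of n l v]) (auto simp: SUP_eq_0_ereal)
qed

lemma subset_tconv: "V \<subseteq> tconv V"
proof
  fix v assume "v \<in> V"
  then have "tcomb {()} (\<lambda>_. 0) (\<lambda>_. v) \<in> tconv V"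
    by (intro tcomb_in_tconv) auto
  then show "v \<in> tconv V"
    by (simp add: tcomb_def)
qed

lemma tconv_mono: "V \<subseteq> W \<Longrightarrow> tconv V \<subseteq> tconv W"
  unfolding tconv_def by blast

lemma tcomb_tcomb:
  assumes "finite I" "\<And>j. j \<in> I \<Longrightarrow> finite (K j) \<and> K j \<noteq> {}"
  shows "tcomb I l (\<lambda>j. tcomb (K j) (m j) (v j)) =
    tcomb (Sigma I K) (\<lambda>(j, k). l j + m j k) (\<lambda>(j, k). v j k)"
proof -
  have "(SUP j\<in>I. l j + (SUP k\<in>K j. m j k + v j k $ i)) =
      (SUP (j, k)\<in>Sigma I K. l j + m j k + v j k $ i)" for i
  proof -
    have "(SUP j\<in>I. l j + (SUP k\<in>K j. m j k + v j k $ i)) = (SUP j\<in>I. SUP k\<in>K j. l j + m j k + v j k $ i)"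
      using assms(2) by (intro SUP_cong refl) (simp add: SUP_add_finite add.assoc)
    also have "\<dots> = (SUP (j, k)\<in>Sigma I K. l j + m j k + v j k $ i)"
      by (intro antisym SUP_least) (auto intro: SUP_upper SUP_upper2)
    finally show ?thesis .
  qed
  then show ?thesis
    by (simp add: tcomb_def vec_eq_iff case_prod_beta)
qed

text \<open>Expanding the points of a combination into generators gives an admissible combination
  again: coefficients stay nonpositive, and a zero outer coefficient meets a zero inner one.\<close>

lemma tcomb_of_tconvE:
  assumes "finite I" "\<And>j. j \<in> I \<Longrightarrow> l j \<le> 0" "\<And>j. j \<in> I \<Longrightarrow> w j \<in> tconv V" "\<exists>j\<in>I. l j = 0"
  obtains K :: "'j \<Rightarrow> nat set" and m u where "\<And>j. j \<in> I \<Longrightarrow> w j = tcomb (K j) (m j) (u j)"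
    "tcomb I l w = tcomb (Sigma I K) (\<lambda>(j, k). l j + m j k) (\<lambda>(j, k). u j k)"
    "finite (Sigma I K)" "\<And>j k. j \<in> I \<Longrightarrow> k \<in> K j \<Longrightarrow> u j k \<in> V \<and> m j k \<le> 0"
    "\<exists>(j, k)\<in>Sigma I K. l j + m j k = 0"
proof -
  have "\<exists>(n :: nat) m u. w j = tcomb {..<n} m u \<and> (\<forall>k<n. m k \<le> 0 \<and> u k \<in> V) \<and> (\<exists>k<n. m k = 0)"
    if "j \<in> I" for j
    using assms(3)[OF that] by (elim tconvE) blast
  then obtain n m u where nmu: "\<And>j. j \<in> I \<Longrightarrow> w j = tcomb {..<(n j :: nat)} (m j) (u j) \<and>
     (\<forall>k<n j. m j k \<le> 0 \<and> u j k \<in> V) \<and> (\<exists>k<n j. m j k = 0)"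
    by metis
  show thesis
  proof (rule that[of "\<lambda>j. {..<n j}" m u])
    have "tcomb I l w = tcomb I l (\<lambda>j. tcomb {..<n j} (m j) (u j))"
      using nmu by (simp add: tcomb_def vec_eq_iff)
    also have "\<dots> = tcomb (Sigma I (\<lambda>j. {..<n j})) (\<lambda>(j, k). l j + m j k) (\<lambda>(j, k). u j k)"
      using assms(1) nmu by (intro tcomb_tcomb) force+
    finally show "tcomb I l w = tcomb (Sigma I (\<lambda>j. {..<n j})) (\<lambda>(j, k). l j + m j k) (\<lambda>(j, k). u j k)" .
    obtain j where j: "j \<in> I" "l j = 0"
      using assms(4) by blast
    then obtain k where "k < n j" "m j k = 0"
      using nmu by blast
    with j show "\<exists>(j, k)\<in>Sigma I (\<lambda>j. {..<n j}). l j + m j k = 0"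
      by (intro bexI[of _ "(j, k)"]) auto
  qed (use assms(1) nmu in auto)
qed

lemma tconv_tconv: "tconv (tconv V) = tconv V"
proof
  show "tconv (tconv V) \<subseteq> tconv V"
  proof
    fix x assume "x \<in> tconv (tconv V)"
    then obtain n l w where w: "x = tcomb {..<n::nat} l w" "\<And>j. j \<in> {..<n} \<Longrightarrow> l j \<le> 0"
      "\<And>j. j \<in> {..<n} \<Longrightarrow> w j \<in> tconv V" "\<exists>j\<in>{..<n}. l j = 0"
      by (elim tconvE) blast
    obtain K :: "nat \<Rightarrow> nat set" and m u where K: "\<And>j. j \<in> {..<n} \<Longrightarrow> w j = tcomb (K j) (m j) (u j)"
      "tcomb {..<n} l w = tcomb (Sigma {..<n} K) (\<lambda>(j, k). l j + m j k) (\<lambda>(j, k). u j k)"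
      "finite (Sigma {..<n} K)" "\<And>j k. j \<in> {..<n} \<Longrightarrow> k \<in> K j \<Longrightarrow> u j k \<in> V \<and> m j k \<le> 0"
      "\<exists>(j, k)\<in>Sigma {..<n} K. l j + m j k = 0"
      by (rule tcomb_of_tconvE[where I = "{..<n}" and l = l and w = w and V = V, OF finite_lessThan w(2,3,4)]) (assumption | rule that)+
    show "x \<in> tconv V"
      unfolding w(1) K(2) using K(3-) w(2)
      by (intro tcomb_in_tconv) (auto intro: add_nonpos_nonpos)
  qed
qed (rule subset_tconv)

text \<open>
  Write \<open>v \<in> V\<close> as a combination of elements of \<open>W\<close>, and these as combinations of elements of \<open>V\<close>.
  If \<open>v\<close> itself occurs in the result with coefficient \<open>0\<close>, it is squeezed to be an element of \<open>W\<close>;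
  otherwise it can be cancelled, so that \<open>V - {v}\<close> still generates.
\<close>

lemma min_generating_subset:
  assumes V: "min_generating P V" and W: "min_generating P W"
  shows "V \<subseteq> W"
proof
  fix v assume v: "v \<in> V"
  have P: "tconv V = P" "tconv W = P" and space: "V \<subseteq> trop_space"
    using V W by (auto simp: min_generating_def)
  have "v \<in> tconv W"
    using v P subset_tconv by blast
  then obtain n l w where w: "v = tcomb {..<n::nat} l w" "\<And>j. j \<in> {..<n} \<Longrightarrow> l j \<le> 0"
      "\<And>j. j \<in> {..<n} \<Longrightarrow> w j \<in> W" "\<exists>j\<in>{..<n}. l j = 0"
    by (elim tconvE) blast
  have wV: "w j \<in> tconv V" if "j \<in> {..<n}" for j
    using w(3)[OF that] P subset_tconv by blast
  obtain K :: "nat \<Rightarrow> nat set" and m u where K: "\<And>j. j \<in> {..<n} \<Longrightarrow> w j = tcomb (K j) (m j) (u j)"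
    "tcomb {..<n} l w = tcomb (Sigma {..<n} K) (\<lambda>(j, k). l j + m j k) (\<lambda>(j, k). u j k)"
    "finite (Sigma {..<n} K)" "\<And>j k. j \<in> {..<n} \<Longrightarrow> k \<in> K j \<Longrightarrow> u j k \<in> V \<and> m j k \<le> 0"
    "\<exists>(j, k)\<in>Sigma {..<n} K. l j + m j k = 0"
    by (rule tcomb_of_tconvE[where I = "{..<n}" and l = l and w = w and V = V, OF finite_lessThan w(2) wV w(4)]) (assumption | rule that)+
  define I where "I = Sigma {..<n} K"
  define c where "c = (\<lambda>(j, k). l j + m j k)"
  define z where "z = (\<lambda>(j, k). u j k)"
  have v_eq: "v = tcomb I c z"
    using w(1) K(2) by (simp add: I_def c_def z_def)
  have finI: "finite I"
    using K(3) by (simp add: I_def)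
  have c0: "c p \<le> 0" and zV: "z p \<in> V" if "p \<in> I" for p
    using that K(4) w(2) by (auto simp: I_def c_def z_def intro: add_nonpos_nonpos)
  obtain p0 where p0: "p0 \<in> I" "c p0 = 0"
    using K(5) by (auto simp: I_def c_def)
  show "v \<in> W"
  proof (cases "\<exists>p\<in>I. z p = v \<and> c p = 0")
    case True
    then obtain j k where jk: "j \<in> {..<n}" "k \<in> K j" "u j k = v" "l j + m j k = 0"
      by (auto simp: I_def z_def c_def)
    have le: "l j \<le> 0" "m j k \<le> 0"
      using jk w(2) K(4) by auto
    have 0: "l j = 0" "m j k = 0"
      using jk(4) le by (cases "l j"; cases "m j k"; auto)+
    have "v = w j"
    proof (rule vec_eq_iff[THEN iffD2], intro allI antisym)
      fix i
      have "m j k + u j k $ i \<le> w j $ i"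
        using SUP_upper[OF jk(2), of "\<lambda>k. m j k + u j k $ i"] by (simp add: K(1)[OF jk(1)] tcomb_def)
      then show "v $ i \<le> w j $ i"
        using 0 jk(3) by simp
      have "l j + w j $ i \<le> v $ i"
        using SUP_upper[OF jk(1), of "\<lambda>j. l j + w j $ i"] by (subst w(1)) (simp add: tcomb_def)
      then show "w j $ i \<le> v $ i"
        using 0 by simp
    qed
    then show ?thesis
      using w(3) jk(1) by simp
  next
    case False
    have absorb: "a = -\<infinity>" if "a = c + a" "c < 0" "a \<noteq> \<infinity>" for a c :: ereal
      using that by (cases a; cases c) auto
    define J where "J = {p \<in> I. z p \<noteq> v}"
    have "v $ i = (SUP p\<in>J. c p + z p $ i)" for i
    proof (rule antisym)
      have le: "(SUP p\<in>J. c p + z p $ i) \<le> (SUP p\<in>I. c p + z p $ i)"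
        by (rule SUP_subset_mono) (auto simp: J_def)
      have vi: "v $ i = (SUP p\<in>I. c p + z p $ i)"
        by (subst v_eq) (simp add: tcomb_def)
      with le show "(SUP p\<in>J. c p + z p $ i) \<le> v $ i"
        by simp
      obtain p where p: "p \<in> I" "v $ i = c p + z p $ i"
        using finite_SUP_attained[OF finI, of "\<lambda>p. c p + z p $ i"] p0(1) vi by auto
      show "v $ i \<le> (SUP p\<in>J. c p + z p $ i)"
      proof (cases "z p = v")
        case True
        then have "c p < 0"
          using False p(1) c0 by (auto simp: less_le)
        moreover have "v $ i \<noteq> \<infinity>"
          using v space by (auto simp: trop_space_def)
        ultimately have "v $ i = -\<infinity>"
          using absorb p(2)[unfolded True] by blast
        then show ?thesis
          by simp
      next
        case False
        then show ?thesis
          using p by (auto simp: J_def intro: SUP_upper)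
      qed
    qed
    then have "v = tcomb J c z"
      by (simp add: tcomb_def vec_eq_iff)
    also have "\<dots> \<in> tconv (V - {v})"
    proof (rule tcomb_in_tconv)
      \<comment> \<open>The index \<open>p0\<close> survives the removal, because in this case
        \<open>v\<close> never occurs with coefficient \<open>0\<close>.\<close>
      show "\<exists>p\<in>J. c p = 0"
        using p0 False by (intro bexI[of _ p0]) (auto simp: J_def)
      show "finite J"
        using finI by (simp add: J_def)
    qed (use c0 zV in \<open>simp_all add: J_def\<close>)
    finally have "V \<subseteq> tconv (V - {v})"
      using subset_tconv[of "V - {v}"] by blast
    then have "tconv V \<subseteq> tconv (V - {v})"
      using tconv_mono tconv_tconv by blast
    then have "tconv (V - {v}) = P"
      using P(1) tconv_mono[of "V - {v}" V] by blast
    then show ?thesis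
      using V v by (auto simp: min_generating_def)
  qed
qed

text \<open>A subset of \<open>V\<close> that is minimal among those generating the same polytope is
  a minimal generating set, and uniqueness identifies it with the vertices.\<close>

lemma tvertices_subset:
  assumes "finite V" "V \<subseteq> trop_space"
  shows "tvertices (tconv V) \<subseteq> V"
proof -
  define \<U> where "\<U> = {U. U \<subseteq> V \<and> tconv U = tconv V}"
  have fin: "finite \<U>" and ne: "\<U> \<noteq> {}"
    using assms(1) by (auto simp: \<U>_def)
  obtain U where U_mem: "U \<in> \<U>" and U_min: "\<forall>W\<in>\<U>. W \<subseteq> U \<longrightarrow> U = W"
    using finite_has_minimal[OF fin ne] by blast
  then have U: "U \<subseteq> V" "tconv U = tconv V"
    by (simp_all add: \<U>_def)
  have min: "U = W" if "W \<subseteq> V" "tconv W = tconv V" "W \<subseteq> U" for W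
    using U_min that by (simp add: \<U>_def)
  have "min_generating (tconv V) U"
    unfolding min_generating_def
  proof (intro conjI allI impI)
    show "U \<subseteq> trop_space"
      using U(1) assms(2) by (rule subset_trans)
    show "tconv W \<noteq> tconv V" if "W \<subset> U" for W
      using min[of W] that U(1) by auto
  qed (rule U(2))
  then have "tvertices (tconv V) = U"
    unfolding tvertices_def using min_generating_subset by (intro the_equality) blast+
  then show ?thesis
    using U by simp
qed

section \<open>Full-dimensional cells and the columns they select\<close>

text \<open>The inequalities for \<open>(i, v)\<close> and \<open>(k, v)\<close> combine to an
  equality between two shifted coordinates. Exponentiation turns it into a nontrivial affine
  equation, so the image lies in a hyperplane.\<close>

lemma aff_dim_texp_cov_cell:
  fixes v :: "ereal^'d"
  assumes b: "b > 0" and G: "(i, v) \<in> G" "(k, v) \<in> G" and ik: "i \<noteq> k"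
    and v: "hcoord v i = ereal \<alpha>" "hcoord v k = ereal \<beta>"
  shows "aff_dim (texp b ` cov_cell G) < int CARD('d)"
proof -
  \<comment> \<open>\<open>E\<close> sends \<open>-\<infinity>\<close> to \<open>0\<close>, so that
    infinite coordinates obey the same equation. Through \<open>u\<close> and \<open>w\<close> the
    homogeneous coordinate \<open>None\<close>, which exponentiates to the constant
    \<open>1\<close>, is treated like the others.\<close>
  define E where "E = (\<lambda>z. if z = -\<infinity> then 0 else b powr real_of_ereal z)"
  define u :: "'d option \<Rightarrow> real^'d" where "u = (\<lambda>n. case n of None \<Rightarrow> 0 | Some m \<Rightarrow> axis m 1)"
  define w :: "'d option \<Rightarrow> real" where "w = (\<lambda>n. case n of None \<Rightarrow> 1 | Some m \<Rightarrow> 0)"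
  define a where "a = (b powr \<beta>) *\<^sub>R u i - (b powr \<alpha>) *\<^sub>R u k"
  define r where "r = b powr \<alpha> * w k - b powr \<beta> * w i"
  have E_add: "E (ereal c + z) = b powr c * E z" if "z \<noteq> \<infinity>" for c z
    using that by (cases z) (auto simp: E_def powr_add)
  have E_hcoord: "E (hcoord y n) = u n \<bullet> texp b y + w n" for y n
    using b by (cases n) (auto simp: E_def u_def w_def texp_def inner_axis')
  have "a \<noteq> 0"
  proof
    assume "a = 0"
    then have a0: "a $ m = 0" for m
      by simp
    show False
    proof (cases i)
      case (Some m)
      then have "a $ m = b powr \<beta>"
        using ik by (cases k) (auto simp: a_def u_def axis_def)
      then show False
        using a0[of m] b by simp
    next
      case None
      then obtain m where "k = Some m"
        using ik by (cases k) auto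
      then have "a $ m = - (b powr \<alpha>)"
        using None by (simp add: a_def u_def axis_def)
      then show False
        using a0[of m] b by simp
    qed
  qed
  have "a \<bullet> texp b y = r" if "y \<in> cov_cell G" for y
  proof -
    have fin: "hcoord y n \<noteq> \<infinity>" for n
      using that by (cases n) (auto simp: cov_cell_def trop_space_def)
    have "hcoord v k + hcoord y i = hcoord v i + hcoord y k"
      using that G by (intro antisym) (fastforce simp: cov_cell_def)+
    then have "E (ereal \<beta> + hcoord y i) = E (ereal \<alpha> + hcoord y k)"
      by (simp add: v)
    then have "b powr \<beta> * (u i \<bullet> texp b y + w i) = b powr \<alpha> * (u k \<bullet> texp b y + w k)"
      by (simp add: E_add fin E_hcoord)
    then show ?thesis
      by (simp add: a_def r_def inner_diff_left algebra_simps)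
  qed
  then have "texp b ` cov_cell G \<subseteq> {z. a \<bullet> z = r}"
    by auto
  then have "aff_dim (texp b ` cov_cell G) \<le> aff_dim {z. a \<bullet> z = r}"
    by (rule aff_dim_subset)
  then show ?thesis
    using \<open>a \<noteq> 0\<close> by simp
qed

lemma trunk_covector:
  fixes M :: "ereal^'m^'d"
  assumes b: "b > 0" and M: "\<And>i j. M $ i $ j \<noteq> \<infinity>"
    and x: "x \<in> trunk b (tconv (columns M))" and fin: "\<And>i. x $ i \<noteq> -\<infinity>"
  obtains e :: "'d option \<Rightarrow> 'm" where "inj e"
    "\<And>i k. hcoord (column (e i) M) k + hcoord x i \<le> hcoord (column (e i) M) i + hcoord x k"
proof -
  have "columns M \<subseteq> trop_space"
    using M by (auto simp: columns_def column_def trop_space_def)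
  then have vert: "tvertices (tconv (columns M)) \<subseteq> columns M"
    by (intro tvertices_subset) (simp_all add: columns_def full_SetCompr_eq)
  obtain G where G: "x \<in> cov_cell G" "aff_dim (texp b ` cov_cell G) = int CARD('d)"
    "G \<subseteq> UNIV \<times> tvertices (tconv (columns M))" "\<forall>i. \<exists>v. (i, v) \<in> G"
    using x by (auto simp: trunk_def closed_cells_def)
  have "\<exists>j. (i, column j M) \<in> G" for i
    using G(3,4) vert by (fastforce simp: columns_def)
  then obtain e where e: "\<And>i. (i, column (e i) M) \<in> G"
    by metis
  have cell: "hcoord (column (e i) M) k + hcoord x i \<le> hcoord (column (e i) M) i + hcoord x k" for i k
    using G(1) e[of i] by (auto simp: cov_cell_def)
  \<comment> \<open>The cell inequality against the index \<open>None\<close>, where all coordinates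
    are \<open>0\<close>, bounds this entry from below by the finite coordinate of
    \<open>x\<close>.\<close>
  have real: "\<exists>\<alpha>. hcoord (column (e i) M) i = ereal \<alpha>" for i
  proof -
    have "hcoord x i \<le> hcoord (column (e i) M) i"
      using cell[of i None] by simp
    moreover have "hcoord x i \<noteq> -\<infinity>"
      using fin by (cases i) auto
    moreover have "hcoord (column (e i) M) i \<noteq> \<infinity>"
      using M by (cases i) (auto simp: column_def)
    ultimately show ?thesis
      by (cases "hcoord (column (e i) M) i") auto
  qed
  have "inj e"
  proof (rule injI, rule ccontr)
    fix i k assume eq: "e i = e k" and ik: "i \<noteq> k"
    obtain \<alpha> \<beta> where "hcoord (column (e i) M) i = ereal \<alpha>" "hcoord (column (e i) M) k = ereal \<beta>"
      using real[of i] real[of k] eq by auto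
    then have "aff_dim (texp b ` cov_cell G) < int CARD('d)"
      using aff_dim_texp_cov_cell[OF b e[of i] _ ik] e[of k] eq by simp
    then show False
      using G(2) by simp
  qed
  then show thesis
    using that cell by blast
qed

section \<open>Polynomials as Puiseux series\<close>

lemma eventually_powr_gt:
  fixes d B :: real
  assumes "d > 0"
  shows "\<forall>\<^sub>F t in at_top. B < t powr d"
  using eventually_gt_at_top[of "(\<bar>B\<bar> + 1) powr (1 / d)"]
proof eventually_elim
  case (elim t)
  have "B < \<bar>B\<bar> + 1"
    by simp
  also have "\<dots> = ((\<bar>B\<bar> + 1) powr (1 / d)) powr d"
    using assms by (simp add: powr_powr)
  also have "\<dots> < t powr d"
    using elim assms by (intro powr_less_mono2) auto
  finally show ?case .
qed

lemma pcoeff_finite: "finite {r. s \<le> r \<and> pcoeff f r \<noteq> 0}"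
  using pcoeff[of f] by blast

lemma pcoeff_summable: "\<forall>\<^sub>F t in at_top. (\<lambda>r. \<bar>pcoeff f r * t powr r\<bar>) summable_on UNIV"
  using pcoeff[of f] by blast

text \<open>The leading term of a nonzero difference outgrows the rest, so the difference cannot
  vanish for all large \<open>t\<close>. This gives the uniqueness behind the description in
  \<open>pvol\<close>.\<close>

lemma peval_eqI:
  assumes "\<forall>\<^sub>F t in at_top. peval t f = peval t g"
  shows "f = g"
proof (rule ccontr)
  assume "f \<noteq> g"
  define h where "h = (\<lambda>r. pcoeff f r - pcoeff g r)"
  have fin: "finite {r. s \<le> r \<and> h r \<noteq> 0}" for s
    by (rule finite_subset[OF _ finite_UnI[OF pcoeff_finite[of s f] pcoeff_finite[of s g]]]) (auto simp: h_def)
  obtain s where s: "h s \<noteq> 0"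
    using \<open>f \<noteq> g\<close> pcoeff_inject[of f g] by (auto simp: h_def)
  define r0 where "r0 = Max {r. s \<le> r \<and> h r \<noteq> 0}"
  have ne: "{r. s \<le> r \<and> h r \<noteq> 0} \<noteq> {}"
    using s by blast
  have r0: "h r0 \<noteq> 0" "s \<le> r0"
    using Max_in[OF fin ne] by (simp_all add: r0_def)
  have r0_max: "r \<le> r0" if "h r \<noteq> 0" for r
    using Max_ge[OF fin[of s], of r] that r0(2) by (cases "s \<le> r") (auto simp: r0_def)
  obtain \<delta> where \<delta>: "\<delta> > 0" "\<And>r. r0 - 1 \<le> r \<Longrightarrow> h r \<noteq> 0 \<Longrightarrow> r \<noteq> r0 \<Longrightarrow> \<delta> \<le> dist r0 r"
    using finite_set_avoid[OF fin[of "r0 - 1"], of r0] by blast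
  \<comment> \<open>Exponents in the support of \<open>h\<close> other than \<open>r0\<close> are at
    least \<open>\<delta>\<close> away if they are above \<open>r0 - 1\<close>, and more than
    \<open>1\<close> away if they are below it.\<close>
  define d where "d = min \<delta> 1"
  have d: "d > 0"
    using \<delta>(1) by (simp add: d_def)
  have gap: "r \<le> r0 - d" if "h r \<noteq> 0" "r \<noteq> r0" for r
    using \<delta>(2)[of r] r0_max[OF that(1)] that by (cases "r0 - 1 \<le> r") (auto simp: d_def dist_real_def)
  have "\<forall>\<^sub>F t in at_top. (\<lambda>r. \<bar>pcoeff f r * t powr r\<bar>) summable_on UNIV \<and>
      (\<lambda>r. \<bar>pcoeff g r * t powr r\<bar>) summable_on UNIV \<and> peval t f = peval t g \<and> t \<ge> (1::real)"
    by (intro eventually_conj pcoeff_summable assms eventually_ge_at_top)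
  then obtain T where T: "\<And>t. t \<ge> T \<Longrightarrow> (\<lambda>r. \<bar>pcoeff f r * t powr r\<bar>) summable_on UNIV \<and>
      (\<lambda>r. \<bar>pcoeff g r * t powr r\<bar>) summable_on UNIV \<and> peval t f = peval t g \<and> t \<ge> 1"
    unfolding eventually_at_top_linorder by blast
  have T1: "T \<ge> 1"
    using T[of T] by simp
  have abs_h: "(\<lambda>r. norm (h r * t powr r)) summable_on UNIV" if "t \<ge> T" for t
  proof (rule Infinite_Sum.abs_summable_on_comparison_test')
    show "(\<lambda>r. \<bar>pcoeff f r * t powr r\<bar> + \<bar>pcoeff g r * t powr r\<bar>) summable_on UNIV"
      using T[OF that] by (intro summable_on_add) auto
    show "norm (h r * t powr r) \<le> \<bar>pcoeff f r * t powr r\<bar> + \<bar>pcoeff g r * t powr r\<bar>" for r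
      using abs_triangle_ineq4[of "pcoeff f r * t powr r" "pcoeff g r * t powr r"]
      by (simp add: h_def left_diff_distrib)
  qed
  have sum_h: "((\<lambda>r. h r * t powr r) has_sum 0) UNIV" if "t \<ge> T" for t
  proof -
    have "(\<lambda>r. pcoeff f r * t powr r) summable_on UNIV"
      by (rule abs_summable_summable) (use T[OF that] in simp)
    moreover have "(\<lambda>r. pcoeff g r * t powr r) summable_on UNIV"
      by (rule abs_summable_summable) (use T[OF that] in simp)
    ultimately have "((\<lambda>r. pcoeff f r * t powr r) has_sum peval t f) UNIV"
      "((\<lambda>r. pcoeff g r * t powr r) has_sum peval t g) UNIV"
      by (simp_all add: peval_def)
    then have "((\<lambda>r. pcoeff f r * t powr r - pcoeff g r * t powr r) has_sum (peval t f - peval t g)) UNIV"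
      unfolding diff_conv_add_uminus by (intro has_sum_add has_sum_uminusI)
    then show ?thesis
      using T[OF that] by (simp add: h_def left_diff_distrib)
  qed
  define S where "S = (\<Sum>\<^sub>\<infinity>r\<in>UNIV. norm (h r * T powr r))"
  \<comment> \<open>The tail at \<open>t\<close> is compared with the absolutely convergent sum at
    the fixed point \<open>T\<close>: for \<open>r \<le> r0 - d\<close>, passing from
    \<open>T\<close> to \<open>t\<close> multiplies a term by at most
    \<open>(t / T) powr (r0 - d)\<close>.\<close>
  have bound: "\<bar>h r0\<bar> * t powr d \<le> S * T powr (d - r0)" if t: "t \<ge> T" for t
  proof -
    have pos: "t > 0" "T > 0"
      using T1 t by auto
    have "infsum (\<lambda>r. h r * t powr r) (UNIV - {r0}) = 0 - h r0 * t powr r0"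
    proof (rule infsumI)
      show "((\<lambda>r. h r * t powr r) has_sum (0 - h r0 * t powr r0)) (UNIV - {r0})"
        by (intro has_sum_Diff sum_h[OF t] has_sum_finiteI) auto
    qed
    moreover have abs_t: "(\<lambda>r. norm (h r * t powr r)) summable_on UNIV - {r0}"
      using abs_h[OF t] by (rule summable_on_subset_banach) auto
    ultimately have "norm (0 - h r0 * t powr r0) \<le> (\<Sum>\<^sub>\<infinity>r\<in>UNIV - {r0}. norm (h r * t powr r))"
      using norm_infsum_bound[of "\<lambda>r. h r * t powr r" "UNIV - {r0}"] by metis
    also have "\<dots> \<le> (\<Sum>\<^sub>\<infinity>r\<in>UNIV. (t / T) powr (r0 - d) * norm (h r * T powr r))"
    proof (rule infsum_mono_neutral)
      show "(\<lambda>r. norm (h r * t powr r)) summable_on UNIV - {r0}"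
        by (rule abs_t)
      show "(\<lambda>r. (t / T) powr (r0 - d) * norm (h r * T powr r)) summable_on UNIV"
        by (intro summable_on_cmult_right abs_h) simp
      fix r assume "r \<in> (UNIV - {r0}) \<inter> UNIV"
      then have r: "r \<noteq> r0"
        by simp
      show "norm (h r * t powr r) \<le> (t / T) powr (r0 - d) * norm (h r * T powr r)"
      proof (cases "h r = 0")
        case False
        have "t powr r = (t / T) powr r * T powr r"
          using pos by (simp add: powr_divide)
        also have "\<dots> \<le> (t / T) powr (r0 - d) * T powr r"
          using gap[OF False r] t pos by (intro mult_right_mono powr_mono) auto
        finally show ?thesis
          by (simp add: abs_mult mult_left_mono mult.left_commute)
      qed simp
    qed auto
    also have "\<dots> = (t / T) powr (r0 - d) * S"
      by (simp add: S_def infsum_cmult_right')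
    finally have "\<bar>h r0\<bar> * t powr r0 \<le> (t / T) powr (r0 - d) * S"
      by (simp add: abs_mult)
    then have "\<bar>h r0\<bar> * t powr r0 * t powr (d - r0) \<le> (t / T) powr (r0 - d) * S * t powr (d - r0)"
      by (intro mult_right_mono) auto
    also have "\<dots> = S * T powr (d - r0) * (t powr (r0 - d) * t powr (d - r0))"
      using pos powr_minus[of T "r0 - d"] by (simp add: powr_divide field_simps)
    also have "t powr (r0 - d) * t powr (d - r0) = 1"
      using pos by (simp add: powr_add[symmetric])
    finally show ?thesis
      by (simp add: mult.assoc powr_add[symmetric])
  qed
  have "\<forall>\<^sub>F t in at_top. S * T powr (d - r0) / \<bar>h r0\<bar> < t powr d \<and> t \<ge> T"
    by (intro eventually_conj eventually_powr_gt d eventually_ge_at_top)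
  then obtain t where "S * T powr (d - r0) / \<bar>h r0\<bar> < t powr d" "t \<ge> T"
    using eventually_happens'[OF trivial_limit_at_top_linorder] by blast
  then show False
    using bound[of t] r0(1) by (simp add: divide_less_eq mult.commute)
qed

text \<open>Nonnegative integral valuations allow polynomials to serve as entries of the lift; its
  volume is then a polynomial for large \<open>t\<close> too.\<close>

definition puiseux_of_poly :: "real poly \<Rightarrow> puiseux" where
  "puiseux_of_poly q = Abs_puiseux (\<lambda>r. if r \<in> \<nat> then coeff q (nat \<lfloor>r\<rfloor>) else 0)"

lemma pcoeff_puiseux_of_poly:
  "pcoeff (puiseux_of_poly q) r = (if r \<in> \<nat> then coeff q (nat \<lfloor>r\<rfloor>) else 0)"
proof -
  define a where "a = (\<lambda>r :: real. if r \<in> \<nat> then coeff q (nat \<lfloor>r\<rfloor>) else 0)"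
  have sub: "{r. a r \<noteq> 0} \<subseteq> real ` {..degree q}"
    by (auto simp: a_def Nats_def intro!: imageI le_degree split: if_splits)
  then have fin: "finite {r. a r \<noteq> 0}"
    by (rule finite_subset) simp
  have "finite {r. s \<le> r \<and> a r \<noteq> 0}" for s
    by (rule finite_subset[OF _ fin]) auto
  moreover have "(\<lambda>r. \<bar>a r * t powr r\<bar>) summable_on UNIV" for t
    using summable_on_cong_neutral[of UNIV "{r. a r \<noteq> 0}" "\<lambda>r. \<bar>a r * t powr r\<bar>" "\<lambda>r. \<bar>a r * t powr r\<bar>"] fin
    by auto
  ultimately have "pcoeff (Abs_puiseux a) = a"
    by (intro Abs_puiseux_inverse) auto
  then show ?thesis
    by (simp add: puiseux_of_poly_def a_def)
qed

lemma pcoeff_puiseux_of_poly_of_nat: "pcoeff (puiseux_of_poly q) (real k) = coeff q k"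
  by (simp add: pcoeff_puiseux_of_poly)

lemma peval_puiseux_of_poly:
  assumes "t > 0"
  shows "peval t (puiseux_of_poly q) = poly q t"
proof -
  have "peval t (puiseux_of_poly q) = infsum (\<lambda>r. pcoeff (puiseux_of_poly q) r * t powr r) (real ` {..degree q})"
    unfolding peval_def
    by (rule infsum_cong_neutral) (auto simp: pcoeff_puiseux_of_poly Nats_def image_iff Ball_def not_le intro!: coeff_eq_0)
  also have "\<dots> = (\<Sum>k\<le>degree q. coeff q k * t ^ k)"
    using assms by (simp add: sum.reindex pcoeff_puiseux_of_poly_of_nat powr_realpow)
  finally show ?thesis
    by (simp add: poly_altdef)
qed

lemma puiseux_of_poly_0: "puiseux_of_poly 0 = 0"
  by (simp add: puiseux_of_poly_def zero_puiseux_def cong: if_cong)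

lemma pval_puiseux_of_poly:
  "pval (puiseux_of_poly q) = (if q = 0 then -\<infinity> else ereal (real (degree q)))"
proof (cases "q = 0")
  case False
  then have lc: "pcoeff (puiseux_of_poly q) (real (degree q)) \<noteq> 0"
    by (simp add: pcoeff_puiseux_of_poly_of_nat)
  have "pcoeff (0 :: puiseux) r = 0" for r
    using pcoeff_puiseux_of_poly[of 0 r] by (simp add: puiseux_of_poly_0)
  with lc have "puiseux_of_poly q \<noteq> 0"
    by metis
  moreover have "(GREATEST r. pcoeff (puiseux_of_poly q) r \<noteq> 0) = real (degree q)"
  proof (rule Greatest_equality)
    show "y \<le> real (degree q)" if "pcoeff (puiseux_of_poly q) y \<noteq> 0" for y
      using that by (auto simp: pcoeff_puiseux_of_poly Nats_def intro: le_degree split: if_splits)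
  qed (rule lc)
  ultimately show ?thesis
    using False by (simp add: pval_def)
qed (simp add: puiseux_of_poly_0 pval_def)

lemma pvol_eqI:
  assumes "\<forall>\<^sub>F t in at_top. measure lebesgue (convex hull (columns (map_matrix (peval t) A))) = poly q t"
  shows "pvol A = puiseux_of_poly q"
  unfolding pvol_def
proof (rule the_equality)
  show ev: "\<forall>\<^sub>F t in at_top. peval t (puiseux_of_poly q) =
      measure lebesgue (convex hull (columns (map_matrix (peval t) A)))"
    using assms eventually_gt_at_top[of 0] by eventually_elim (simp add: peval_puiseux_of_poly)
  show "f = puiseux_of_poly q"
    if "\<forall>\<^sub>F t in at_top. peval t f = measure lebesgue (convex hull (columns (map_matrix (peval t) A)))" for f
  proof (rule peval_eqI)
    show "\<forall>\<^sub>F t in at_top. peval t f = peval t (puiseux_of_poly q)"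
      using that ev by eventually_elim simp
  qed
qed

text \<open>For \<open>t \<ge> 1\<close> a polynomial is at most the sum of its absolute
  coefficients times \<open>t ^ degree q\<close>. The zero polynomial is excluded separately, as its
  valuation is not its degree.\<close>

lemma degree_ge_of_powr_le:
  fixes q :: "real poly"
  assumes ev: "\<forall>\<^sub>F t in at_top. c * t powr s \<le> poly q t" and c: "c > 0"
  shows "q \<noteq> 0 \<and> s \<le> real (degree q)"
proof -
  define B where "B = (\<Sum>k\<le>degree q. \<bar>coeff q k\<bar>)"
  have "\<forall>\<^sub>F t in at_top. c * t powr (s - real (degree q)) \<le> B"
    using ev eventually_ge_at_top[of 1]
  proof eventually_elim
    case (elim t)
    have "c * t powr s \<le> (\<Sum>k\<le>degree q. coeff q k * t ^ k)"
      using elim(1) by (simp add: poly_altdef)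
    also have "\<dots> \<le> (\<Sum>k\<le>degree q. \<bar>coeff q k\<bar> * t ^ degree q)"
      using elim(2) by (intro sum_mono mult_mono power_increasing) auto
    also have "\<dots> = B * t powr real (degree q)"
      using elim(2) by (simp add: B_def sum_distrib_right powr_realpow)
    finally show ?case
      using elim(2) by (simp add: powr_diff field_simps)
  qed
  moreover have "\<forall>\<^sub>F t in at_top. B < c * t powr (s - real (degree q))" if "s > real (degree q)"
    using eventually_powr_gt[of "s - real (degree q)" "B / c"] that c
    by (simp add: divide_less_eq mult.commute)
  ultimately have "s \<le> real (degree q)"
    using eventually_conj eventually_happens'[OF trivial_limit_at_top_linorder]
    by (metis (mono_tags, lifting) not_le)
  moreover have "q \<noteq> 0"
  proof
    assume "q = 0"
    obtain t where "c * t powr s \<le> poly q t" "t > 0"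
      using eventually_happens'[OF trivial_limit_at_top_linorder
          eventually_conj[OF ev eventually_gt_at_top[of 0]]] by blast
    with \<open>q = 0\<close> c show False
      by (simp add: mult_le_0_iff)
  qed
  ultimately show ?thesis
    by blast
qed

section \<open>Lifting a simplex\<close>

text \<open>This is continuity of the determinant in entrywise form. It supplies one coefficient
  \<open>\<delta>\<close> for the lift that works for every \<open>t\<close>.\<close>

lemma det_ge_half_near_mat_1:
  obtains \<delta> :: real where "\<delta> > 0"
    "\<And>B :: real^'n^'n. (\<And>i k. \<bar>B $ i $ k - mat 1 $ i $ k\<bar> \<le> \<delta>) \<Longrightarrow> 1 / 2 \<le> det B"
proof -
  have "continuous (at (mat 1)) (det :: real^'n^'n \<Rightarrow> real)"
    unfolding det_def by (intro continuous_intros)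
  then obtain d where d: "d > 0" "\<And>B :: real^'n^'n. dist B (mat 1) < d \<Longrightarrow> dist (det B) (det (mat 1 :: real^'n^'n)) < 1 / 2"
    unfolding continuous_at_eps_delta by (metis half_gt_zero_iff zero_less_one)
  define N where "N = real CARD('n)"
  have N: "N > 0"
    by (simp add: N_def)
  show thesis
  proof
    \<comment> \<open>The distance to the identity is at most the sum of the \<open>N * N\<close>
      entrywise deviations, hence at most \<open>d / 2\<close>.\<close>
    show "d / (2 * N * N) > 0"
      using d(1) N by simp
    fix B :: "real^'n^'n"
    assume B: "\<And>i k. \<bar>B $ i $ k - mat 1 $ i $ k\<bar> \<le> d / (2 * N * N)"
    have "norm (B - mat 1) \<le> (\<Sum>i\<in>UNIV. norm ((B - mat 1) $ i))"
      unfolding norm_vec_def by (intro L2_set_le_sum) auto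
    also have "\<dots> \<le> (\<Sum>i\<in>(UNIV :: 'n set). \<Sum>k\<in>(UNIV :: 'n set). d / (2 * N * N))"
    proof (rule sum_mono)
      fix i
      have "norm ((B - mat 1) $ i) \<le> (\<Sum>k\<in>UNIV. \<bar>(B - mat 1) $ i $ k\<bar>)"
        by (rule norm_le_l1_cart)
      also have "\<dots> \<le> (\<Sum>k\<in>(UNIV :: 'n set). d / (2 * N * N))"
        using B by (intro sum_mono) simp
      finally show "norm ((B - mat 1) $ i) \<le> (\<Sum>k\<in>(UNIV :: 'n set). d / (2 * N * N))" .
    qed
    also have "\<dots> = d / 2"
      using N by (simp add: N_def)
    finally have "dist B (mat 1) < d"
      using d(1) by (simp add: dist_norm)
    then have "\<bar>det B - 1\<bar> < 1 / 2"
      using d(2)[of B] by (simp add: dist_real_def)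
    then show "1 / 2 \<le> det B"
      by linarith
  qed
qed

text \<open>Every term of the Leibniz expansion uses each row and each column exactly once.\<close>

lemma det_scale:
  fixes B :: "'a::comm_ring_1^'n^'n"
  shows "det (\<chi> i k. r i * c k * B $ i $ k) = prod r UNIV * prod c UNIV * det B"
  unfolding det_def sum_distrib_left
proof (rule sum.cong[OF refl])
  fix p :: "'n \<Rightarrow> 'n" assume "p \<in> {p. p permutes UNIV}"
  then have "(\<Prod>i\<in>UNIV. c (p i)) = prod c UNIV"
    using prod.permute[of p UNIV c] by (simp add: o_def)
  then show "of_int (sign p) * (\<Prod>i\<in>UNIV. (\<chi> i k. r i * c k * B $ i $ k) $ i $ p i) =
      prod r UNIV * prod c UNIV * (of_int (sign p) * (\<Prod>i\<in>UNIV. B $ i $ p i))"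
    by (simp add: prod.distrib mult_ac)
qed

lemma pval_le_qtvol_upper: "map_matrix pval A = M \<Longrightarrow> pval (pvol A) \<le> qtvol_upper M"
  unfolding qtvol_upper_def by (intro Sup_upper) blast

text \<open>
  The lift takes the coefficient \<open>1\<close> at the entries \<open>(i, e (Some i))\<close> and a small \<open>\<delta>\<close> elsewhere.
  Rescaling row \<open>i\<close> by \<open>t\<close> to the power \<open>- x $ i\<close> and column \<open>k\<close> by \<open>t\<close> to the power
  \<open>- w k\<close>, where \<open>w k \<ge> 0\<close>, brings the edge matrix of the simplex \<open>e\<close> close to the identity.
\<close>

lemma lift_volume:
  fixes M :: "ereal^'m^'d" and e :: "'d option \<Rightarrow> 'm" and x :: "real^'d"
  assumes M: "\<And>i j. M $ i $ j = -\<infinity> \<or> M $ i $ j = ereal (real (N i j))"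
    and e: "inj e"
    and None_le: "\<And>k. M $ k $ e None \<le> ereal (x $ k)"
    and Some_ge: "\<And>i. ereal (x $ i) \<le> M $ i $ e (Some i)"
    and Some_le: "\<And>i k. M $ k $ e (Some i) + ereal (x $ i) \<le> M $ i $ e (Some i) + ereal (x $ k)"
  shows "ereal (\<Sum>i\<in>UNIV. x $ i) \<le> qtvol_upper M"
proof -
  obtain \<delta> :: real where \<delta>: "\<delta> > 0"
    "\<And>B :: real^'d^'d. (\<And>i k. \<bar>B $ i $ k - mat 1 $ i $ k\<bar> \<le> \<delta>) \<Longrightarrow> 1 / 2 \<le> det B"
    using det_ge_half_near_mat_1 by blast
  define c where "c = (\<lambda>i j. if j = e (Some i) then 1 else \<delta>)"
  define p where "p = (\<lambda>j i. if M $ i $ j = -\<infinity> then 0 else monom (c i j) (N i j))"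
  define A :: "puiseux^'m^'d" where "A = (\<chi> i j. puiseux_of_poly (p j i))"
  have c0: "c i j \<noteq> 0" for i j
    using \<delta>(1) by (simp add: c_def)
  have "pval (puiseux_of_poly (p j i)) = M $ i $ j" for i j
    using M[of i j] c0[of i j] by (auto simp: p_def pval_puiseux_of_poly degree_monom_eq)
  then have valA: "map_matrix pval A = M"
    by (simp add: A_def map_matrix_def vec_eq_iff)
  define v :: "real \<Rightarrow> 'm \<Rightarrow> real^'d" where "v = (\<lambda>t j. \<chi> i. poly (p j i) t)"
  have cols: "columns (map_matrix (peval t) A) = range (v t)" if "t > 0" for t
    using that by (auto simp: columns_def column_def A_def map_matrix_def v_def peval_puiseux_of_poly)
  obtain q where q: "\<forall>\<^sub>F t in at_top. measure lebesgue (convex hull (range (v t))) = poly q t"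
    unfolding v_def using eventually_poly_measure_convex_hull by blast
  have "\<forall>\<^sub>F t in at_top. measure lebesgue (convex hull (columns (map_matrix (peval t) A))) = poly q t"
    using q eventually_gt_at_top[of 0] by eventually_elim (simp add: cols)
  then have pvolA: "pvol A = puiseux_of_poly q"
    by (rule pvol_eqI)
  \<comment> \<open>The excess of the diagonal exponent over \<open>x $ i\<close>; with it,
    rescaling turns the diagonal monomials into exactly \<open>1\<close>.\<close>
  define w where "w = (\<lambda>i. real (N i (e (Some i))) - x $ i)"
  have diag: "M $ i $ e (Some i) = ereal (x $ i + w i)" for i
    using M[of i "e (Some i)"] Some_ge[of i] by (auto simp: w_def)
  have w0: "w i \<ge> 0" for i
    using Some_ge[of i] by (simp add: diag)
  have val: "poly (p j i) t = (if M $ i $ j = -\<infinity> then 0 else c i j * t powr real (N i j))"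
    if "t > 0" for i j t
    using that by (simp add: p_def poly_monom powr_realpow)
  \<comment> \<open>The lower bound \<open>0\<close> matters: the difference of two such entries is
    then bounded by \<open>\<delta> * t powr s\<close> without a factor \<open>2\<close>.\<close>
  have small: "0 \<le> poly (p j i) t \<and> poly (p j i) t \<le> \<delta> * t powr s"
    if "t \<ge> 1" "M $ i $ j \<le> ereal s" "j \<noteq> e (Some i)" for t i j s
  proof (cases "M $ i $ j = -\<infinity>")
    case False
    then have "real (N i j) \<le> s"
      using M[of i j] that(2) by auto
    then have "t powr real (N i j) \<le> t powr s"
      using that(1) by (intro powr_mono) auto
    then show ?thesis
      using False that \<delta>(1) by (simp add: val c_def)
  qed (use that \<delta>(1) in \<open>simp add: val\<close>)
  have bound: "t powr (\<Sum>i\<in>UNIV. x $ i) / (2 * fact CARD('d)) \<le> measure lebesgue (convex hull (range (v t)))"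
    if t: "t \<ge> 1" for t
  proof -
    define B :: "real^'d^'d" where
      "B = (\<chi> i k. (v t (e (Some k)) $ i - v t (e None) $ i) / (t powr (x $ i) * t powr w k))"
    have "\<bar>B $ i $ k - mat 1 $ i $ k\<bar> \<le> \<delta>" for i k
    proof -
      have pos: "t powr (x $ i + w k) > 0"
        using t by simp
      have "M $ i $ e None \<le> ereal (x $ i + w k)"
        using None_le[of i] w0[of k] by (metis add_increasing2 ereal_less_eq(3) order_refl order_trans)
      \<comment> \<open>Injectivity of \<open>e\<close> ensures that, among the columns of the
        simplex, only \<open>e (Some i)\<close> has coefficient \<open>1\<close> in row
        \<open>i\<close>.\<close>
      moreover have "e None \<noteq> e (Some i)"
        using e by (simp add: inj_eq)
      ultimately have n: "0 \<le> v t (e None) $ i \<and> v t (e None) $ i \<le> \<delta> * t powr (x $ i + w k)"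
        using small[OF t] by (simp add: v_def)
      have B: "B $ i $ k = (v t (e (Some k)) $ i - v t (e None) $ i) / t powr (x $ i + w k)"
        by (simp add: B_def powr_add)
      show ?thesis
      proof (cases "i = k")
        case True
        have "v t (e (Some k)) $ i = t powr (x $ i + w k)"
          using t diag[of k] True M[of k "e (Some k)"] by (auto simp: v_def val c_def)
        then have "B $ i $ k - mat 1 $ i $ k = - (v t (e None) $ i / t powr (x $ i + w k))"
          unfolding B using pos True by (simp add: mat_def diff_divide_distrib)
        then show ?thesis
          using n pos by (simp add: divide_le_eq)
      next
        case False
        have "M $ i $ e (Some k) \<le> ereal (x $ i + w k)"
          using Some_le[of i k] by (cases "M $ i $ e (Some k)") (auto simp: diag)
        moreover have "e (Some k) \<noteq> e (Some i)"
          using e False by (simp add: inj_eq)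
        ultimately have "0 \<le> v t (e (Some k)) $ i \<and> v t (e (Some k)) $ i \<le> \<delta> * t powr (x $ i + w k)"
          using small[OF t] by (simp add: v_def)
        with n have "\<bar>v t (e (Some k)) $ i - v t (e None) $ i\<bar> \<le> \<delta> * t powr (x $ i + w k)"
          by linarith
        then show ?thesis
          using pos False by (simp add: B mat_def divide_le_eq)
      qed
    qed
    then have detB: "1 / 2 \<le> det B"
      by (rule \<delta>(2))
    have "(\<chi> i k. v t (e (Some k)) $ i - v t (e None) $ i) = (\<chi> i k. t powr (x $ i) * t powr w k * B $ i $ k)"
      using t by (simp add: B_def vec_eq_iff)
    then have "det (\<chi> i k. v t (e (Some k)) $ i - v t (e None) $ i) =
        (\<Prod>i\<in>UNIV. t powr (x $ i)) * (\<Prod>k\<in>UNIV. t powr w k) * det B"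
      by (simp only: det_scale)
    also have "\<dots> = t powr (\<Sum>i\<in>UNIV. x $ i) * t powr (\<Sum>k\<in>UNIV. w k) * det B"
      using t by (simp add: powr_sum)
    also have "\<dots> \<ge> t powr (\<Sum>i\<in>UNIV. x $ i) * 1 * (1 / 2)"
      using t w0 detB by (intro mult_mono ge_one_powr_ge_zero sum_nonneg) auto
    finally have "t powr (\<Sum>i\<in>UNIV. x $ i) / 2 \<le> \<bar>det (\<chi> i k. v t (e (Some k)) $ i - v t (e None) $ i)\<bar>"
      by simp
    then have "t powr (\<Sum>i\<in>UNIV. x $ i) / (2 * fact CARD('d)) \<le> measure lebesgue (convex hull (range (v t \<circ> e)))"
      by (simp add: measure_simplex_vec divide_right_mono flip: divide_divide_eq_left)
    also have "\<dots> \<le> measure lebesgue (convex hull (range (v t)))"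
      by (intro measure_mono_fmeasurable hull_mono fmeasurableD)
        (auto intro!: lmeasurable_compact finite_imp_compact_convex_hull)
    finally show ?thesis .
  qed
  have "\<forall>\<^sub>F t in at_top. 1 / (2 * fact CARD('d)) * t powr (\<Sum>i\<in>UNIV. x $ i) \<le> poly q t"
    using q eventually_ge_at_top[of 1] by eventually_elim (use bound in fastforce)
  then have "q \<noteq> 0 \<and> (\<Sum>i\<in>UNIV. x $ i) \<le> real (degree q)"
    by (rule degree_ge_of_powr_le) simp
  then have "ereal (\<Sum>i\<in>UNIV. x $ i) \<le> pval (pvol A)"
    by (simp add: pvolA pval_puiseux_of_poly)
  then show ?thesis
    using pval_le_qtvol_upper[OF valA] by (rule order_trans)
qed

theorem theorem4p13:
  fixes M :: "ereal^'m^'d" and P :: "(ereal^'d) set" and b :: real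
  assumes "b > 1"
    and "\<And>i j. M $ i $ j = -\<infinity> \<or> (\<exists>k::nat. M $ i $ j = ereal (real k))"
    and "P = tconv (columns M)"
  shows "tbvol b P \<le> qtvol_upper M"
  unfolding tbvol_def
proof (rule SUP_least)
  fix x assume x: "x \<in> trunk b P"
  have x_space: "x $ i \<noteq> \<infinity>" for i
    using x by (auto simp: trunk_def closed_cells_def cov_cell_def trop_space_def)
  show "(\<Sum>i\<in>UNIV. x $ i) \<le> qtvol_upper M"
  proof (cases "\<exists>i. x $ i = -\<infinity>")
    \<comment> \<open>As no coordinate is \<open>\<infinity>\<close>, a single coordinate
      \<open>-\<infinity>\<close> makes the whole sum \<open>-\<infinity>\<close>.\<close>
    case True
    then obtain i where "x $ i = -\<infinity>"
      by blast
    moreover have "(\<Sum>i\<in>UNIV - {i}. x $ i) \<noteq> \<infinity>"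
      using x_space by (simp add: sum_Pinfty)
    ultimately have "(\<Sum>i\<in>UNIV. x $ i) = -\<infinity>"
      by (simp add: sum.remove[of UNIV i])
    then show ?thesis
      by simp
  next
    case False
    obtain N where N: "\<And>i j. M $ i $ j = -\<infinity> \<or> M $ i $ j = ereal (real (N i j))"
      using assms(2) by metis
    then have M_ne: "M $ i $ j \<noteq> \<infinity>" for i j
      by (metis MInfty_neq_PInfty(1) PInfty_neq_ereal(1))
    obtain e :: "'d option \<Rightarrow> 'm" where e: "inj e"
      "\<And>i k. hcoord (column (e i) M) k + hcoord x i \<le> hcoord (column (e i) M) i + hcoord x k"
      using trunk_covector[of b M x] assms(1,3) x M_ne False by auto
    define y :: "real^'d" where "y = (\<chi> i. real_of_ereal (x $ i))"
    have y: "x $ i = ereal (y $ i)" for i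
      using x_space[of i] False by (auto simp: y_def ereal_real)
    have "ereal (\<Sum>i\<in>UNIV. y $ i) \<le> qtvol_upper M"
    \<comment> \<open>The three kinds of sector inequality, according to which of the two indices is
      \<open>None\<close>, are the three hypotheses on \<open>x\<close>.\<close>
    proof (rule lift_volume[OF N e(1)])
      show "M $ k $ e None \<le> ereal (y $ k)" for k
        using e(2)[of None "Some k"] by (simp add: column_def y)
      show "ereal (y $ i) \<le> M $ i $ e (Some i)" for i
        using e(2)[of "Some i" None] by (simp add: column_def y)
      show "M $ k $ e (Some i) + ereal (y $ i) \<le> M $ i $ e (Some i) + ereal (y $ k)" for i k
        using e(2)[of "Some i" "Some k"] by (simp add: column_def y)
    qed
    then show ?thesis
      by (simp add: y)
  qed
qed

end
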